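(* Let $K$ be a field of characteristic zero, $a\ge2$ an integer, $F(q)=1+\sum_{n\ge1}f_nq^n\in K[[q]]$, and suppose $f_1\ne0,-1$. There is a unique $x_0(q)\in K[[q^a]]$ with $$x_0(0)=\frac1{1+f_1},\qquad M(x_0(q),q)=0.$$ Set $\varrho(q)=-\dfrac{N(x_0(q),q)}{M_x(x_0(q),q)}$, where $M_x=\partial M/\partial x$. Then $$\varrho(q)=-\frac{f_1}{(1+f_1)^2}q^{1-a}+O(q^{2-a}).$$ For every $r\ge0$, the coefficient of $q^{r-a+1}$ in $$R(x/q^a,q)-\frac{\varrho(q)}{x_0(q)-x}$$ is a polynomial in $x$ of degree at most $\lceil r/a\rceil$. Therefore $$[q^{am-a+1+r}]C_m(q)=[q^{r-a+1}]\,\varrho(q)x_0(q)^{-m-1}\qquad\text{if }m\ge\lceil r/a\rceil+1.$$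
   Context: Define $$R(X,q)=\frac{\sum_{m\ge0}X^mF(q^{am+1})}{\sum_{m\ge0}X^mF(q^{a(m+1)})}=\sum_{m\ge0}C_m(q)X^m\quad\text{in }K[[q]][[X]],$$ and $$N(x,q)=(1-x)F(q)+f_1x(q-q^{1-a})+x(1-x)\sum_{n\ge2}f_n\frac{q^{n-a}(q^{an}-1)}{1-xq^{a(n-1)}},$$ $$M(x,q)=(1-x)F(q^a)+f_1x(q^a-1)+x(1-x)\sum_{n\ge2}f_n\frac{q^{a(n-1)}(q^{an}-1)}{1-xq^{a(n-1)}},$$ with the denominators expanded geometrically. At every $q$-degree, $N$ and $M$ have coefficients that are polynomials in $x$; $N$ has no powers of $q$ below $q^{1-a}$; $M$ involves only nonnegative powers of $q^a$; and $R(x/q^a,q)=N/M$ in $K[[x]]((q))$. The expression $1/(x_0(q)-x)$ is likewise expanded in $K[[x]]((q))$. $[q^n]$ denotes the coefficient of $q^n$; $O(q^n)$ means that only powers $q^j$ with $j\ge n$ occur. *)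

theory Defs
  imports
    "HOL-Computational_Algebra.Computational_Algebra"
    "HOL-Analysis.Infinite_Sum"
begin

unbundle fps_syntax
notation fls_nth (infixl \<open>$$\<close> 75)

text \<open>
  The inner series variable is the first one in brackets: \<open>K[[q]][[X]]\<close> is \<open>'a fps fps\<close>, while
  \<open>K[x]((q))\<close> is \<open>'a poly fls\<close> and \<open>K[[x]]((q))\<close> is \<open>'a fps fls\<close>.  Infinite sums of Laurent series
  are taken with respect to the \<open>q\<close>-adic metric of the library, so that the coefficient rings
  \<open>K[x]\<close> and \<open>K[[x]]\<close> carry the discrete topology.
\<close>

text \<open>Only meaningful for functions with \<open>h 0 = 0\<close>.\<close>

definition fls_map_coeffs :: "('a::zero \<Rightarrow> 'b::zero) \<Rightarrow> 'a fls \<Rightarrow> 'b fls" where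
  "fls_map_coeffs h P = Abs_fls (\<lambda>j. h (P $$ j))"

text \<open>The value at \<open>x = g(q)\<close> of a series in \<open>K[x]((q))\<close>.\<close>

definition fls_eval :: "'a::field poly fls \<Rightarrow> 'a fps \<Rightarrow> 'a fls" where
  "fls_eval P g =
     (\<Sum>\<^sub>\<infinity>j. fps_to_fls (poly (map_poly fps_const (P $$ j)) g) * fls_X_intpow j)"

text \<open>The ring \<open>K[[q\<^sup>a]]\<close>.\<close>

definition fps_in_power :: "nat \<Rightarrow> 'a::field fps set" where
  "fps_in_power a = range (\<lambda>h. h oo fps_X ^ a)"

definition R_series :: "nat \<Rightarrow> 'a::field fps \<Rightarrow> 'a fps fps" where
  "R_series a F =
     Abs_fps (\<lambda>m. F oo fps_X ^ (a * m + 1)) / Abs_fps (\<lambda>m. F oo fps_X ^ (a * (m + 1)))"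

definition C_coeff :: "nat \<Rightarrow> 'a::field fps \<Rightarrow> nat \<Rightarrow> 'a fps" where
  "C_coeff a F m = R_series a F $ m"

text \<open>
  The series \<open>R(x/q\<^sup>a, q) = \<Sum>\<^sub>m C\<^sub>m(q) q\<^sup>-\<^sup>a\<^sup>m x\<^sup>m\<close>, re-expanded by powers of \<open>q\<close>; that only finitely many
  negative powers of \<open>q\<close> occur is part of \<open>R_subst_nth\<close> below.
\<close>

definition R_subst :: "nat \<Rightarrow> 'a::field fps \<Rightarrow> 'a fps fls" where
  "R_subst a F =
     Abs_fls (\<lambda>j. Abs_fps (\<lambda>m. fps_to_fls (C_coeff a F m) $$ (j + int a * int m)))"

definition fls_geometric :: "'a::comm_ring_1 fls \<Rightarrow> 'a fls" where
  "fls_geometric y = (\<Sum>\<^sub>\<infinity>k. y ^ k)"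

definition N_series :: "nat \<Rightarrow> 'a::field fps \<Rightarrow> 'a poly fls" where
  "N_series a F =
     (let x = fls_const [:0, 1:]; f = (\<lambda>n. fls_const [:F $ n:]); q = fls_X_intpow in
        (1 - x) * fls_map_coeffs (\<lambda>c. [:c:]) (fps_to_fls F)
        + f 1 * x * (q 1 - q (1 - int a))
        + x * (1 - x) *
          (\<Sum>\<^sub>\<infinity>n\<in>{2..}. f n * (q (int n - int a) * (q (int a * int n) - 1)
             * fls_geometric (x * q (int a * (int n - 1))))))"

definition M_series :: "nat \<Rightarrow> 'a::field fps \<Rightarrow> 'a poly fls" where
  "M_series a F =
     (let x = fls_const [:0, 1:]; f = (\<lambda>n. fls_const [:F $ n:]); q = fls_X_intpow in
        (1 - x) * fls_map_coeffs (\<lambda>c. [:c:]) (fps_to_fls (F oo fps_X ^ a))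
        + f 1 * x * (q (int a) - 1)
        + x * (1 - x) *
          (\<Sum>\<^sub>\<infinity>n\<in>{2..}. f n * (q (int a * (int n - 1)) * (q (int a * int n) - 1)
             * fls_geometric (x * q (int a * (int n - 1))))))"

definition M_x_series :: "nat \<Rightarrow> 'a::field fps \<Rightarrow> 'a poly fls" where
  "M_x_series a F = fls_map_coeffs pderiv (M_series a F)"

definition rho_series :: "nat \<Rightarrow> 'a::field fps \<Rightarrow> 'a fps \<Rightarrow> 'a fls" where
  "rho_series a F x0 = - (fls_eval (N_series a F) x0 / fls_eval (M_x_series a F) x0)"

text \<open>
  The expansion of \<open>\<rho>(q)/(x\<^sub>0(q) - x)\<close> in \<open>K[[x]]((q))\<close>.  The division is that of \<^typ>\<open>'a fps fls\<close>; it is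
  exact as the lowest coefficient \<open>x\<^sub>0(0) - x\<close> of the denominator is a unit of \<open>K[[x]]\<close>.
\<close>

definition pole_part :: "'a::field fls \<Rightarrow> 'a fps \<Rightarrow> 'a fps fls" where
  "pole_part \<rho> x0 =
     fls_map_coeffs fps_const \<rho> / (fls_map_coeffs fps_const (fps_to_fls x0) - fls_const fps_X)"

text \<open>The remaining facts show that the encodings above are not degenerate.\<close>

lemma fls_map_coeffs_nth:
  assumes "h 0 = 0"
  shows "fls_map_coeffs h P $$ j = h (P $$ j)"
proof -
  obtain N where "\<forall>n<N. P $$ n = 0" by (rule fls_nth_vanishes_belowE)
  thus ?thesis unfolding fls_map_coeffs_def
    by (intro nth_Abs_fls_lower_bound[where N = N]) (auto simp: assms)
qed

lemma fls_has_sum: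
  fixes T :: "'i \<Rightarrow> 'a::ab_group_add fls"
  assumes fin: "\<And>J. finite {n \<in> A. \<exists>j\<le>J. T n $$ j \<noteq> 0}"
  shows "(T has_sum Abs_fls (\<lambda>j. \<Sum>n | n \<in> A \<and> T n $$ j \<noteq> 0. T n $$ j)) A"
    and "(\<Sum>\<^sub>\<infinity>n\<in>A. T n) $$ j = (\<Sum>n | n \<in> A \<and> T n $$ j \<noteq> 0. T n $$ j)"
proof -
  define S where "S = Abs_fls (\<lambda>j. \<Sum>n | n \<in> A \<and> T n $$ j \<noteq> 0. T n $$ j)"
  have "\<exists>N. \<forall>j<N. \<forall>n\<in>B. T n $$ j = 0" if "finite B" for B
    using that
  proof (induction B)
    case (insert b B)
    then obtain N where N: "\<forall>j<N. \<forall>n\<in>B. T n $$ j = 0" by auto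
    obtain L where "\<forall>j<L. T b $$ j = 0" by (rule fls_nth_vanishes_belowE)
    with N show ?case by (intro exI[of _ "min N L"]) auto
  qed auto
  from this[OF fin[of 0]] obtain N
    where N: "\<And>j n. j < N \<Longrightarrow> n \<in> A \<Longrightarrow> \<exists>j\<le>0. T n $$ j \<noteq> 0 \<Longrightarrow> T n $$ j = 0" by auto
  have S_nth: "S $$ j = (\<Sum>n | n \<in> A \<and> T n $$ j \<noteq> 0. T n $$ j)" for j
    unfolding S_def
  proof (rule nth_Abs_fls_lower_bound[where N = "min N 0"], intro allI impI)
    fix j assume j: "j < min N 0"
    have "{n \<in> A. T n $$ j \<noteq> 0} = {}"
      using N[of j] j by (auto, metis less_imp_le)
    thus "(\<Sum>n | n \<in> A \<and> T n $$ j \<noteq> 0. T n $$ j) = 0" by (metis (no_types) sum.empty)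
  qed
  have sum_nth: "sum T X $$ j = (\<Sum>n\<in>X. T n $$ j)" for X j
    by (induction X rule: infinite_finite_induct) auto
  have "(sum T \<longlongrightarrow> S) (finite_subsets_at_top A)"
  proof (rule tendstoI)
    fix e :: real assume "e > 0"
    then obtain J :: nat where J: "inverse (2 ^ J) < e"
      using reals_power_lt_ex[of e 2] by (auto simp: power_inverse field_simps)
    show "eventually (\<lambda>X. dist (sum T X) S < e) (finite_subsets_at_top A)"
      unfolding eventually_finite_subsets_at_top
    proof (intro exI[of _ "{n \<in> A. \<exists>j\<le>int J. T n $$ j \<noteq> 0}"] conjI allI impI)
      show "finite {n \<in> A. \<exists>j\<le>int J. T n $$ j \<noteq> 0}" by (rule fin)
      fix X assume X: "finite X \<and> {n \<in> A. \<exists>j\<le>int J. T n $$ j \<noteq> 0} \<subseteq> X \<and> X \<subseteq> A"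
      have eq: "(sum T X - S) $$ j = 0" if "j \<le> int J" for j
      proof -
        have "(\<Sum>n\<in>X. T n $$ j) = (\<Sum>n | n \<in> A \<and> T n $$ j \<noteq> 0. T n $$ j)"
          using X that by (intro sum.mono_neutral_right) auto
        thus ?thesis by (simp add: sum_nth S_nth)
      qed
      show "dist (sum T X) S < e"
      proof (cases "sum T X = S")
        case False
        hence "(sum T X - S) $$ fls_subdegree (sum T X - S) \<noteq> 0"
          by (intro nth_fls_subdegree_nonzero) simp
        hence J': "fls_subdegree (sum T X - S) > int J" using eq by (metis not_le)
        have "inverse (2 ^ nat (fls_subdegree (sum T X - S))) \<le> (inverse (2 ^ J) :: real)"
          using J' by (intro le_imp_inverse_le power_increasing) auto
        also note J
        finally show ?thesis using False J' by (simp add: dist_fls_def)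
      qed (use \<open>e > 0\<close> in simp)
    qed auto
  qed
  thus hs: "(T has_sum Abs_fls (\<lambda>j. \<Sum>n | n \<in> A \<and> T n $$ j \<noteq> 0. T n $$ j)) A"
    by (simp add: has_sum_def S_def)
  show "(\<Sum>\<^sub>\<infinity>n\<in>A. T n) $$ j = (\<Sum>n | n \<in> A \<and> T n $$ j \<noteq> 0. T n $$ j)"
    using infsumI[OF hs] S_nth[of j] by (simp add: S_def)
qed

lemma fls_eval_nth:
  "fls_eval P g $$ n =
     (\<Sum>j = fls_subdegree P..n. poly (map_poly fps_const (P $$ j)) g $ nat (n - j))"
proof -
  define T where "T = (\<lambda>j. fps_to_fls (poly (map_poly fps_const (P $$ j)) g) * fls_X_intpow j)"
  have T_nth: "T j $$ n = (if j \<le> n then poly (map_poly fps_const (P $$ j)) g $ nat (n - j) else 0)"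
    for j n by (simp add: T_def fls_X_intpow_times_conv_shift)
  have T0: "T j = 0" if "j < fls_subdegree P" for j
    using that by (simp add: T_def)
  have fin: "finite {j \<in> UNIV. \<exists>k\<le>J. T j $$ k \<noteq> 0}" for J
  proof (rule finite_subset)
    show "{j \<in> UNIV. \<exists>k\<le>J. T j $$ k \<noteq> 0} \<subseteq> {fls_subdegree P..J}"
    proof clarify
      fix j k assume "k \<le> J" "T j $$ k \<noteq> 0"
      moreover from this have "j \<ge> fls_subdegree P" using T0[of j] by (metis fls_zero_nth not_le)
      ultimately show "j \<in> {fls_subdegree P..J}" by (auto simp: T_nth split: if_splits)
    qed
  qed simp
  have "fls_eval P g $$ n = (\<Sum>j | j \<in> UNIV \<and> T j $$ n \<noteq> 0. T j $$ n)"
    unfolding fls_eval_def T_def[symmetric] by (rule fls_has_sum(2)[OF fin])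
  also have "\<dots> = (\<Sum>j = fls_subdegree P..n. T j $$ n)"
  proof (rule sum.mono_neutral_left)
    show "{j \<in> UNIV. T j $$ n \<noteq> 0} \<subseteq> {fls_subdegree P..n}"
    proof clarify
      fix j assume "T j $$ n \<noteq> 0"
      moreover from this have "j \<ge> fls_subdegree P" using T0[of j] by (metis fls_zero_nth not_le)
      ultimately show "j \<in> {fls_subdegree P..n}" by (auto simp: T_nth split: if_splits)
    qed
  qed auto
  also have "\<dots> = (\<Sum>j = fls_subdegree P..n. poly (map_poly fps_const (P $$ j)) g $ nat (n - j))"
    by (rule sum.cong) (auto simp: T_nth)
  finally show ?thesis .
qed

lemma fls_geometric_monom_nth:
  fixes c :: "'a::comm_ring_1"
  assumes "d > 0"
  shows "fls_geometric (fls_const c * fls_X_intpow d) $$ j =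
           (if j \<ge> 0 \<and> d dvd j then c ^ nat (j div d) else 0)"
proof -
  define T where "T = (\<lambda>k. (fls_const c * fls_X_intpow d) ^ k)"
  have T: "T k $$ j = (if j = int k * d then c ^ k else 0)" for k j
    unfolding T_def power_mult_distrib fls_X_intpow_power fls_const_power[symmetric]
    by (simp add: fls_X_intpow_times_conv_shift)
  have fin: "finite {k \<in> UNIV. \<exists>j\<le>J. T k $$ j \<noteq> 0}" for J
  proof (rule finite_subset)
    show "{k \<in> UNIV. \<exists>j\<le>J. T k $$ j \<noteq> 0} \<subseteq> {..nat J}"
    proof
      fix k assume "k \<in> {k \<in> UNIV. \<exists>j\<le>J. T k $$ j \<noteq> 0}"
      then obtain j where "j \<le> J" "T k $$ j \<noteq> 0" by auto
      hence "int k * d \<le> J" by (auto simp: T split: if_splits)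
      moreover have "int k * 1 \<le> int k * d" using assms by (intro mult_left_mono) auto
      ultimately show "k \<in> {..nat J}" by auto
    qed
  qed simp
  have eq: "fls_geometric (fls_const c * fls_X_intpow d) $$ j =
          (\<Sum>k | k \<in> UNIV \<and> T k $$ j \<noteq> 0. T k $$ j)"
    unfolding fls_geometric_def T_def[symmetric] by (rule fls_has_sum(2)[OF fin])
  show ?thesis
  proof (cases "j \<ge> 0 \<and> d dvd j")
    case True
    then obtain k where k: "j = int k * d"
      using assms by (metis dvd_div_mult_self nonneg_int_cases pos_imp_zdiv_nonneg_iff)
    have "(\<Sum>i | i \<in> UNIV \<and> T i $$ j \<noteq> 0. T i $$ j) = (\<Sum>i\<in>{k}. T i $$ j)"
      using assms by (intro sum.mono_neutral_left) (auto simp: T k split: if_splits)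
    with eq have "fls_geometric (fls_const c * fls_X_intpow d) $$ j = T k $$ j" by simp
    thus ?thesis using True assms by (simp add: T k)
  next
    case False
    hence "T k $$ j = 0" for k using assms by (auto simp: T)
    thus ?thesis using False by (auto simp: eq)
  qed
qed

lemma N_M_terms_summable:
  fixes c :: "nat \<Rightarrow> 'a::comm_ring_1"
  assumes a: "a \<ge> 1" and e: "\<And>n. n \<ge> 2 \<Longrightarrow> e n \<ge> int n - int a"
  shows "(\<lambda>n. fls_const (c n) * (fls_X_intpow (e n) * (fls_X_intpow (int a * int n) - 1)
             * fls_geometric (fls_const p * fls_X_intpow (int a * (int n - 1))))) summable_on {2..}"
    (is "?T summable_on _")
proof -
  have order: "?T n $$ j = 0" if n: "n \<ge> 2" and j: "j < e n" for n j
  proof -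
    define b where "b = int a * (int n - 1)"
    have b: "b > 0" using a n by (simp add: b_def)
    define g where "g = Abs_fps (\<lambda>i. if b dvd int i then p ^ nat (int i div b) else 0)"
    have g: "fls_geometric (fls_const p * fls_X_intpow b) = fps_to_fls g"
      by (rule fls_eqI) (auto simp: fls_geometric_monom_nth[OF b] g_def)
    have d: "fls_X_intpow (int a * int n) = (fps_to_fls (fps_X ^ (a * n)) :: 'a fls)"
      by (simp add: fps_to_fls_power fls_X_power_conv_shift_1)
    have "?T n = fls_X_intpow (e n) * fps_to_fls (fps_const (c n) * (fps_X ^ (a * n) - 1) * g)"
      unfolding b_def[symmetric] g d
      by (simp add: fls_times_fps_to_fls mult_ac)
    thus ?thesis using j by (simp add: fls_X_intpow_times_conv_shift)
  qed
  have "finite {n \<in> {2..}. \<exists>j\<le>J. ?T n $$ j \<noteq> 0}" for J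
  proof (rule finite_subset)
    show "{n \<in> {2..}. \<exists>j\<le>J. ?T n $$ j \<noteq> 0} \<subseteq> {..nat (J + int a)}"
    proof
      fix n assume "n \<in> {n \<in> {2..}. \<exists>j\<le>J. ?T n $$ j \<noteq> 0}"
      then obtain j where n: "n \<ge> 2" and j: "j \<le> J" "?T n $$ j \<noteq> 0" by blast
      hence "e n \<le> j" using order[OF n, of j] by linarith
      thus "n \<in> {..nat (J + int a)}" using e[OF n] j(1) by simp
    qed
  qed simp
  thus ?thesis by (rule has_sum_imp_summable[OF fls_has_sum(1)])
qed

lemma fps_divide_unit:
  fixes A B :: "'a::field fps fps"
  assumes "B $ 0 $ 0 \<noteq> 0"
  shows "A / B * B = A"
proof -
  have B0: "B $ 0 \<noteq> 0" using assms by auto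
  hence sd: "subdegree B = 0" by simp
  have "B * inverse B = 1"
    unfolding fps_inverse_def[of B]
    by (intro fps_right_inverse inverse_mult_eq_1') (rule assms)
  thus ?thesis by (simp add: fps_divide_def sd mult.assoc mult.commute[of _ B])
qed

lemma R_series_mult:
  assumes "F $ 0 = 1"
  shows "R_series a F * Abs_fps (\<lambda>m. F oo fps_X ^ (a * (m + 1))) =
           Abs_fps (\<lambda>m. F oo fps_X ^ (a * m + 1))"
  unfolding R_series_def by (rule fps_divide_unit) (simp add: assms)

lemma C_coeff_order:
  assumes a: "a \<ge> 1" and F0: "F $ 0 = 1" and j: "j + a \<le> a * m"
  shows "C_coeff a F m $ j = 0"
proof -
  define A where "A = (\<lambda>m. F oo fps_X ^ (a * m + 1))"
  define B where "B = (\<lambda>m. F oo fps_X ^ (a * (m + 1)))"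
  define L :: "'a fps fps" where "L = (1 - fps_X) * (1 - fps_const (fps_X ^ a) * fps_X)"
  define D where "D = L * Abs_fps B"
  have small: "(F oo fps_X ^ d) $ i = (if i = 0 then 1 else 0)" if "i < d" for i d
    using that F0 by (auto simp: fps_nth_compose_X_power dest: dvd_imp_le)
  have A_small: "A m $ i = (if i = 0 then 1 else 0)" if "i \<le> a * m" for i m
    unfolding A_def by (rule small) (use that in linarith)
  have B_small: "B m $ i = (if i = 0 then 1 else 0)" if "i < a * m + a" for i m
    unfolding B_def by (rule small) (use that in simp)
  have L_nth: "(L * P) $ m = P $ m - (if m \<ge> 1 then (1 + fps_X ^ a) * P $ (m - 1) else 0)
      + (if m \<ge> 2 then fps_X ^ a * P $ (m - 2) else 0)" for P m
  proof -
    have "L * P = P - fps_const (1 + fps_X ^ a) * (fps_X * P)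
                    + fps_const (fps_X ^ a) * (fps_X ^ 2 * P)"
      by (simp add: L_def algebra_simps power2_eq_square flip: fps_const_add)
    thus ?thesis
      by (simp add: fps_X_power_mult_nth)
  qed
  have num: "(L * Abs_fps A) $ m $ j = 0" if "j + a \<le> a * m" for j m
  proof -
    have "m \<noteq> 0" using that a by (intro notI) simp
    then obtain k where m: "m = Suc k" by (cases m) auto
    have j: "j \<le> a * k" using that by (simp add: m)
    show ?thesis
    proof (cases k)
      case 0
      thus ?thesis using j a unfolding L_nth m by (simp add: A_def small F0 algebra_simps)
    next
      case (Suc l)
      have "A m $ j = (if j = 0 then 1 else 0)" "A k $ j = (if j = 0 then 1 else 0)"
        using A_small[of j m] A_small[of j k] j by (simp_all add: m)
      moreover have "(fps_X ^ a * A k) $ j = (if j = a then 1 else 0)"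
        unfolding fps_X_power_mult_nth using j by (auto simp: A_small)
      moreover have "(fps_X ^ a * A l) $ j = (if j = a then 1 else 0)"
        unfolding fps_X_power_mult_nth using j Suc by (auto simp: A_small)
      ultimately show ?thesis
        using a by (simp add: L_nth m Suc distrib_right)
    qed
  qed
  have den: "D $ m $ j = 0" if "j < a * m" for j m
  proof -
    have "m \<noteq> 0" using that by (intro notI) simp
    then obtain k where m: "m = Suc k" by (cases m) auto
    have j: "j < a * k + a" using that by (simp add: m)
    have 1: "B m $ j = (if j = 0 then 1 else 0)" "B k $ j = (if j = 0 then 1 else 0)"
      using B_small[of j m] B_small[of j k] j by (simp_all add: m)
    have 2: "(fps_X ^ a * B k) $ j = (if j = a then 1 else 0)"
      unfolding fps_X_power_mult_nth using j by (auto simp: B_small)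
    show ?thesis
    proof (cases k)
      case 0
      thus ?thesis using 1 2 j a unfolding D_def L_nth m by (simp add: distrib_right)
    next
      case (Suc l)
      have "(fps_X ^ a * B l) $ j = (if j = a then 1 else 0)"
        unfolding fps_X_power_mult_nth using j Suc by (auto simp: B_small)
      thus ?thesis using 1 2 by (simp add: D_def L_nth m Suc distrib_right)
    qed
  qed
  have DR: "D * R_series a F = L * Abs_fps A"
    unfolding D_def using R_series_mult[OF F0, of a] by (simp add: A_def B_def mult_ac)
  have D0: "D $ 0 = B 0" unfolding D_def L_nth by simp
  show ?thesis using j
  proof (induction m arbitrary: j rule: less_induct)
    case (less m)
    define C where "C = C_coeff a F"
    define G where "G = (L * Abs_fps A) $ m - (\<Sum>i=1..m. D $ i * C (m - i))"
    have "(L * Abs_fps A) $ m = (\<Sum>i=0..m. D $ i * C (m - i))"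
      unfolding DR[symmetric] by (simp add: fps_mult_nth C_def C_coeff_def)
    also have "\<dots> = D $ 0 * C m + (\<Sum>i=1..m. D $ i * C (m - i))"
      by (simp add: sum.atLeast_Suc_atMost)
    finally have "B 0 * C m = G" by (simp add: G_def D0)
    moreover have "inverse (B 0) * B 0 = 1" by (rule inverse_mult_eq_1) (simp add: B_def F0)
    ultimately have C: "C m = inverse (B 0) * G" by (metis mult.assoc mult_1)
    have G: "G $ j = 0" if j: "j + a \<le> a * m" for j
    proof -
      have "(D $ i * C (m - i)) $ j = 0" if i: "i \<in> {1..m}" for i
        unfolding fps_mult_nth
      proof (intro sum.neutral ballI)
        fix k assume k: "k \<in> {0..j}"
        show "D $ i $ k * C (m - i) $ (j - k) = 0"
        proof (cases "k < a * i")
          case False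
          have "a * (m - i) = a * m - a * i" by (simp add: diff_mult_distrib2)
          hence "(j - k) + a \<le> a * (m - i)" using False j k by auto
          hence "C (m - i) $ (j - k) = 0" unfolding C_def using i by (intro less.IH) auto
          thus ?thesis by simp
        qed (simp add: den)
      qed
      thus ?thesis using num[OF j] by (simp add: G_def fps_sum_nth)
    qed
    have "C m $ j = 0"
      unfolding C fps_mult_nth using less.prems by (intro sum.neutral) (auto intro!: G)
    thus ?case by (simp add: C_def)
  qed
qed

lemma R_subst_nth:
  assumes "a \<ge> 1" "F $ 0 = 1"
  shows "R_subst a F $$ j = Abs_fps (\<lambda>m. fps_to_fls (C_coeff a F m) $$ (j + int a * int m))"
    and "j < 1 - int a \<Longrightarrow> R_subst a F $$ j = 0"
proof -
  have *: "Abs_fps (\<lambda>m. fps_to_fls (C_coeff a F m) $$ (j + int a * int m)) = 0"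
    if "j < 1 - int a" for j
  proof (rule fps_ext)
    fix m
    have "nat (j + int a * int m) + a \<le> a * m" if "j + int a * int m \<ge> 0"
      using that \<open>j < 1 - int a\<close> by (simp add: nat_le_iff flip: of_nat_mult)
    thus "Abs_fps (\<lambda>m. fps_to_fls (C_coeff a F m) $$ (j + int a * int m)) $ m = 0 $ m"
      using C_coeff_order[OF assms] by auto
  qed
  show 1: "R_subst a F $$ j = Abs_fps (\<lambda>m. fps_to_fls (C_coeff a F m) $$ (j + int a * int m))" for j
    unfolding R_subst_def by (rule nth_Abs_fls_lower_bound[where N = "1 - int a"]) (use * in auto)
  show "j < 1 - int a \<Longrightarrow> R_subst a F $$ j = 0"
    unfolding 1 by (rule *)
qed

lemma pole_part_mult:
  assumes "x0 $ 0 \<noteq> 0"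
  shows "pole_part \<rho> x0 * (fls_map_coeffs fps_const (fps_to_fls x0) - fls_const fps_X) =
           fls_map_coeffs fps_const \<rho>"
proof -
  define D where "D = Abs_fps (\<lambda>n. fps_const (x0 $ n)) - fps_const fps_X"
  have D: "fls_map_coeffs fps_const (fps_to_fls x0) - fls_const fps_X = fps_to_fls D"
    by (rule fls_eqI) (auto simp: D_def fls_map_coeffs_nth)
  have D00: "D $ 0 $ 0 \<noteq> 0" using assms by (simp add: D_def)
  hence sd: "subdegree D = 0" by (metis fps_zero_nth subdegree_eq_0_iff)
  have sd': "fls_subdegree (fps_to_fls D) = 0" by (simp add: fls_subdegree_fls_to_fps sd)
  define r where "r = fls_map_coeffs fps_const \<rho>"
  have base: "fls_base_factor_to_fps (fps_to_fls D) = D"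
    using sd by (simp only: fls_base_factor_to_fps_to_fls fps_unit_factor_def fps_shift_0)
  have "r / fps_to_fls D * fps_to_fls D =
          fls_shift (- fls_subdegree r)
            (fps_to_fls (fls_base_factor_to_fps r / D * D))"
    by (simp add: fls_divide_def base sd' fls_shifted_times_simps fls_times_fps_to_fls)
  also have "\<dots> = r"
    unfolding fps_divide_unit[OF D00]
    by (rule fls_conv_base_factor_to_fps_shift_subdegree[symmetric])
  finally show ?thesis by (simp add: pole_part_def D r_def)
qed

end

theory Submission
  imports Defs
begin

text \<open>
  Write \<open>M\<close> and \<open>n = q\<^sup>a\<^sup>-\<^sup>1 N\<close> as power series in \<open>q\<close> with coefficients in \<open>K[x]\<close>; their \<open>q\<^sup>r\<close>-coefficients
  have degrees at most \<open>\<lfloor>r/a\<rfloor> + 1\<close> and \<open>\<lceil>r/a\<rceil> + 1\<close>.  Since \<open>M = 1 - (1 + f\<^sub>1) x\<close> modulo \<open>q\<close>, the root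
  \<open>x\<^sub>0\<close> is the fixed point of a \<open>q\<close>-adic contraction that preserves \<open>K[[q\<^sup>a]]\<close>.  Synthetic division lowers
  all degrees by one: \<open>M = (x\<^sub>0 - x) H\<close>, where \<open>H\<close> is a unit because its lowest coefficient is
  \<open>1 + f\<^sub>1\<close>, and \<open>M\<^sub>x = - H\<close> at \<open>x = x\<^sub>0\<close>.  With \<open>c = n(x\<^sub>0)/H(x\<^sub>0)\<close> this gives \<open>\<rho> = q\<^sup>1\<^sup>-\<^sup>a c\<close>, and
  \<open>n - c H = (x\<^sub>0 - x) T\<close>.  Hence \<open>N/M - \<rho>/(x\<^sub>0 - x) = q\<^sup>1\<^sup>-\<^sup>a T/H\<close>, whose \<open>q\<^sup>r\<^sup>-\<^sup>a\<^sup>+\<^sup>1\<close>-coefficient has degree at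
  most \<open>\<lceil>r/a\<rceil>\<close> because \<open>\<lfloor>i/a\<rfloor> + \<lceil>j/a\<rceil> \<le> \<lceil>(i + j)/a\<rceil>\<close>.

  All identities between rational functions of \<open>x\<close> are compared in the domain \<open>K((q))[[x]]\<close>, where
  \<open>M\<close> and \<open>N\<close> are the rescaled denominator and numerator of \<open>R\<close>, both multiplied by
  \<open>(1 - x)(1 - q\<^sup>-\<^sup>a x)\<close>.
\<close>

section \<open>The diagonal of a double power series\<close>

text \<open>The substitution \<open>Y = q\<close> in \<open>K[[q]][[Y]]\<close>.\<close>

definition fps_diag :: "'a::comm_ring_1 fps fps \<Rightarrow> 'a fps" where
  "fps_diag A = Abs_fps (\<lambda>n. \<Sum>i\<le>n. A $ i $ (n - i))"

lemma fps_diag_nth: "fps_diag A $ n = (\<Sum>i\<le>n. A $ i $ (n - i))"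
  by (simp add: fps_diag_def)

lemma fps_diag_const [simp]: "fps_diag (fps_const g) = g"
proof (rule fps_ext)
  fix n
  have "(\<Sum>i\<le>n. fps_const g $ i $ (n - i)) = (\<Sum>i\<in>{0}. fps_const g $ i $ (n - i))"
    by (rule sum.mono_neutral_right) auto
  thus "fps_diag (fps_const g) $ n = g $ n" by (simp add: fps_diag_nth)
qed

lemma fps_diag_coeffs: "fps_diag (Abs_fps (\<lambda>j. fps_const (h $ j))) = h"
proof (rule fps_ext)
  fix n
  have "(\<Sum>i\<le>n. fps_const (h $ i) $ (n - i)) = (\<Sum>i\<in>{n}. fps_const (h $ i) $ (n - i))"
    by (rule sum.mono_neutral_right) auto
  thus "fps_diag (Abs_fps (\<lambda>j. fps_const (h $ j))) $ n = h $ n" by (simp add: fps_diag_nth)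
qed

lemma fps_diag_add: "fps_diag (A + B) = fps_diag A + fps_diag B"
  by (rule fps_ext) (simp add: fps_diag_nth sum.distrib)

text \<open>Both sides sum \<open>A $ k $ l * B $ u $ v\<close> over
  \<open>k + l + u + v = n\<close>: the left groups by the outer degree \<open>k + u\<close>, the
  right by the degree \<open>k + l\<close> taken up by \<open>A\<close>.\<close>

lemma fps_diag_mult: "fps_diag (A * B) = fps_diag A * fps_diag B"
proof (rule fps_ext)
  fix n :: nat
  let ?S = "Sigma {..n} (\<lambda>i. {0..i} \<times> {0..n - i})"
  let ?T = "Sigma {0..n} (\<lambda>s. {..s} \<times> {..n - s})"
  have "fps_diag (A * B) $ n =
      (\<Sum>i\<le>n. \<Sum>k=0..i. \<Sum>l=0..n - i. A $ k $ l * B $ (i - k) $ (n - i - l))"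
    by (simp add: fps_diag_nth fps_mult_nth fps_sum_nth)
  also have "\<dots> = (\<Sum>(i, k, l)\<in>?S. A $ k $ l * B $ (i - k) $ (n - i - l))"
    by (simp add: sum.Sigma sum.cartesian_product)
  also have "\<dots> = (\<Sum>(s, k, u)\<in>?T. A $ k $ (s - k) * B $ u $ (n - s - u))"
    by (rule sum.reindex_bij_witness[where i = "\<lambda>(s, k, u). (k + u, k, s - k)"
          and j = "\<lambda>(i, k, l). (k + l, k, i - k)"]) (auto simp: add.commute)
  also have "\<dots> = (\<Sum>s=0..n. \<Sum>k\<le>s. \<Sum>u\<le>n - s. A $ k $ (s - k) * B $ u $ (n - s - u))"
    by (simp add: sum.Sigma sum.cartesian_product)
  also have "\<dots> = (fps_diag A * fps_diag B) $ n"
    by (simp add: fps_diag_nth fps_mult_nth sum_product)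
  finally show "fps_diag (A * B) $ n = (fps_diag A * fps_diag B) $ n" .
qed

section \<open>Substitution of a power series for x\<close>

definition poly_at :: "'a::field poly \<Rightarrow> 'a fps \<Rightarrow> 'a fps" where
  "poly_at p g = poly (map_poly fps_const p) g"

lemma poly_at_0 [simp]: "poly_at 0 g = 0"
  by (simp add: poly_at_def)

lemma poly_at_pCons [simp]: "poly_at (pCons c p) g = fps_const c + g * poly_at p g"
  by (simp add: poly_at_def map_poly_pCons)

lemma poly_at_add: "poly_at (p + q) g = poly_at p g + poly_at q g"
  by (induction p q rule: poly_induct2) (simp_all add: algebra_simps flip: fps_const_add)

lemma poly_at_smult: "poly_at (smult c p) g = fps_const c * poly_at p g"
  by (induction p) (simp_all add: algebra_simps)

lemma poly_at_mult: "poly_at (p * q) g = poly_at p g * poly_at q g"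
  by (induction p) (simp_all add: poly_at_add poly_at_smult algebra_simps)

lemma poly_at_sum: "poly_at (\<Sum>i\<in>A. p i) g = (\<Sum>i\<in>A. poly_at (p i) g)"
  by (induction A rule: infinite_finite_induct) (simp_all add: poly_at_add)

text \<open>Substitution is q-adically non-expansive; this makes the iteration in
  \<open>root_exists\<close> a contraction.\<close>

lemma poly_at_nth_cong:
  assumes "\<And>k. k \<le> n \<Longrightarrow> g $ k = h $ k"
  shows "poly_at p g $ n = poly_at p h $ n"
  using assms
proof (induction p arbitrary: n)
  case (pCons c p)
  have "poly_at p g $ k = poly_at p h $ k" if "k \<le> n" for k
    by (rule pCons.IH) (use pCons.prems that in auto)
  hence "(g * poly_at p g) $ n = (h * poly_at p h) $ n"
    unfolding fps_mult_nth by (intro sum.cong refl) (simp add: pCons.prems)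
  thus ?case by simp
qed simp

text \<open>The outer variable holds the powers of q from \<open>P\<close>, the inner one those from
  \<open>g\<close>; the diagonal merges them, so multiplicativity comes from
  \<open>fps_diag_mult\<close>.\<close>

definition eval_at :: "'a::field poly fps \<Rightarrow> 'a fps \<Rightarrow> 'a fps" where
  "eval_at P g = fps_diag (Abs_fps (\<lambda>j. poly_at (P $ j) g))"

lemma eval_at_nth: "eval_at P g $ n = (\<Sum>j\<le>n. poly_at (P $ j) g $ (n - j))"
  by (simp add: eval_at_def fps_diag_nth)

lemma eval_at_add: "eval_at (P + Q) g = eval_at P g + eval_at Q g"
  by (rule fps_ext) (simp add: eval_at_nth poly_at_add sum.distrib)

lemma eval_at_mult: "eval_at (P * Q) g = eval_at P g * eval_at Q g"
proof -
  have "Abs_fps (\<lambda>j. poly_at ((P * Q) $ j) g) =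
      Abs_fps (\<lambda>j. poly_at (P $ j) g) * Abs_fps (\<lambda>j. poly_at (Q $ j) g)"
    by (rule fps_ext) (simp add: fps_mult_nth poly_at_sum poly_at_mult)
  thus ?thesis by (simp add: eval_at_def fps_diag_mult)
qed

definition fps_of_coeffs :: "'a::comm_ring_1 fps \<Rightarrow> 'a poly fps" where
  "fps_of_coeffs g = Abs_fps (\<lambda>n. [:g $ n:])"

lemma fps_of_coeffs_nth [simp]: "fps_of_coeffs g $ n = [:g $ n:]"
  by (simp add: fps_of_coeffs_def)

lemma fps_of_coeffs_add: "fps_of_coeffs (g + h) = fps_of_coeffs g + fps_of_coeffs h"
  by (rule fps_ext) simp

lemma fps_of_coeffs_const: "fps_of_coeffs (fps_const c) = fps_const [:c:]"
  by (rule fps_ext) simp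

lemma sum_const_poly: "(\<Sum>i\<in>A. [:f i:]) = [:\<Sum>i\<in>A. f i:]"
  by (induction A rule: infinite_finite_induct) simp_all

lemma fps_of_coeffs_mult: "fps_of_coeffs (g * h) = fps_of_coeffs g * fps_of_coeffs h"
  by (rule fps_ext) (simp add: fps_mult_nth mult.commute flip: sum_const_poly)

lemma eval_at_fps_of_coeffs [simp]: "eval_at (fps_of_coeffs h) g = h"
  by (simp add: eval_at_def fps_diag_coeffs)

lemma eval_at_const: "eval_at (fps_const p) g = poly_at p g"
proof -
  have "Abs_fps (\<lambda>j. poly_at (fps_const p $ j) g) = fps_const (poly_at p g)"
    by (rule fps_ext) simp
  thus ?thesis by (simp add: eval_at_def)
qed

section \<open>Synthetic division by g - x\<close>

definition root_factor :: "'a::field fps \<Rightarrow> 'a poly fps" where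
  "root_factor g = fps_of_coeffs g - fps_const [:0, 1:]"

lemma eval_at_diff: "eval_at (P - Q) g = eval_at P g - eval_at Q g"
  using eval_at_add[of "P - Q" Q g] by simp

lemma eval_at_root_factor: "eval_at (root_factor h) g = h - g"
  by (simp add: root_factor_def eval_at_diff eval_at_const)

text \<open>Horner induction: since x = g - (g - x), passing from \<open>p\<close> to
  \<open>c + x p\<close> replaces \<open>S\<close> by \<open>x S - p(g)\<close>. Bounding by
  coefficients makes \<open>S\<close> vanish for constant \<open>p\<close>.\<close>

lemma poly_division:
  "\<exists>S. fps_const p = fps_of_coeffs (poly_at p g) + root_factor g * S \<and>
       (\<forall>n i. i \<ge> degree p \<longrightarrow> coeff (S $ n) i = 0)"
proof (induction p)
  case 0
  show ?case by (intro exI[of _ 0]) (simp add: fps_eq_iff)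
next
  case (pCons c p)
  show ?case
  proof (cases "p = 0")
    case True
    thus ?thesis by (intro exI[of _ 0]) (simp add: fps_of_coeffs_const)
  next
    case False
    obtain S where S: "fps_const p = fps_of_coeffs (poly_at p g) + root_factor g * S"
      and deg: "\<And>n i. i \<ge> degree p \<Longrightarrow> coeff (S $ n) i = 0"
      using pCons.IH by blast
    have "fps_const (pCons c p) = fps_const [:c:] + fps_const [:0, 1:] * fps_const p"
      by simp
    also have "\<dots> = fps_of_coeffs (poly_at (pCons c p) g) +
        root_factor g * (fps_const [:0, 1:] * S - fps_of_coeffs (poly_at p g))"
      unfolding S root_factor_def poly_at_pCons fps_of_coeffs_add fps_of_coeffs_mult
        fps_of_coeffs_const
      by (simp add: algebra_simps del: fps_const_mult fps_const_add)
    finally show ?thesis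
      using False
      by (intro exI[of _ "fps_const [:0, 1:] * S - fps_of_coeffs (poly_at p g)"])
        (auto simp: coeff_pCons deg split: nat.splits)
  qed
qed

text \<open>Each \<open>P $ j\<close> is divided separately, and the remainders add up to
  \<open>P(g) = 0\<close>. The quotient of \<open>P $ j\<close> is itself a series in q and reaches
  every degree n >= j, whence the monotonicity of \<open>w\<close>.\<close>

lemma root_division:
  assumes w: "mono w" and deg: "\<And>n. degree (P $ n) \<le> Suc (w n)" and root: "eval_at P g = 0"
  obtains Q where "P = root_factor g * Q" and "\<And>n. degree (Q $ n) \<le> w n"
proof -
  have "\<forall>j. \<exists>S. fps_const (P $ j) = fps_of_coeffs (poly_at (P $ j) g) + root_factor g * S \<and>
       (\<forall>n i. i \<ge> degree (P $ j) \<longrightarrow> coeff (S $ n) i = 0)"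
    by (intro allI poly_division)
  then obtain S where S: "\<And>j. fps_const (P $ j) =
        fps_of_coeffs (poly_at (P $ j) g) + root_factor g * S j"
      and S_deg: "\<And>j n i. i \<ge> degree (P $ j) \<Longrightarrow> coeff (S j $ n) i = 0"
    by metis
  define Q where "Q = fps_diag (Abs_fps S)"
  have rem: "fps_diag (Abs_fps (\<lambda>j. fps_of_coeffs (poly_at (P $ j) g))) = fps_of_coeffs (eval_at P g)"
    by (rule fps_ext) (simp add: fps_diag_nth eval_at_nth sum_const_poly)
  have "Abs_fps (\<lambda>j. fps_const (P $ j)) = Abs_fps (\<lambda>j. fps_of_coeffs (poly_at (P $ j) g)) +
      fps_const (root_factor g) * Abs_fps S"
    by (rule fps_ext) (simp add: S)
  \<comment> \<open>The division identities are collected in an outer variable, and the ring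
    homomorphism \<open>fps_diag\<close> is applied.\<close>
  hence "P = fps_of_coeffs (eval_at P g) + root_factor g * Q"
    using fps_diag_coeffs[of P] rem unfolding Q_def by (metis fps_diag_add fps_diag_mult fps_diag_const)
  moreover have "fps_of_coeffs 0 = (0 :: 'a poly fps)" by (rule fps_ext) simp
  ultimately have "P = root_factor g * Q" by (simp add: root)
  moreover have "degree (Q $ n) \<le> w n" for n
  proof (rule degree_le, intro allI impI)
    fix i assume i: "w n < i"
    have "coeff (S j $ (n - j)) i = 0" if "j \<le> n" for j
      using monoD[OF w that] deg[of j] i by (intro S_deg) linarith
    thus "coeff (Q $ n) i = 0" by (simp add: Q_def fps_diag_nth coeff_sum)
  qed
  ultimately show thesis by (rule that)
qed

section \<open>The ring K[[q^a]] and existence of the root\<close>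

lemma fps_in_power_iff:
  assumes "a > 0"
  shows "g \<in> fps_in_power a \<longleftrightarrow> (\<forall>n. \<not> a dvd n \<longrightarrow> g $ n = 0)"
proof
  assume "g \<in> fps_in_power a"
  thus "\<forall>n. \<not> a dvd n \<longrightarrow> g $ n = 0"
    using assms by (auto simp: fps_in_power_def fps_nth_compose_X_power)
next
  assume *: "\<forall>n. \<not> a dvd n \<longrightarrow> g $ n = 0"
  have "g = Abs_fps (\<lambda>n. g $ (n * a)) oo fps_X ^ a"
    using assms * by (intro fps_ext) (auto simp: fps_nth_compose_X_power)
  thus "g \<in> fps_in_power a" unfolding fps_in_power_def by blast
qed

lemma fps_in_power_mult:
  assumes a: "a > 0" and "g \<in> fps_in_power a" "h \<in> fps_in_power a"
  shows "g * h \<in> fps_in_power a"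
proof -
  have "g $ i * h $ (n - i) = 0" if "\<not> a dvd n" "i \<le> n" for n i
  proof (cases "a dvd i")
    case True
    hence "\<not> a dvd n - i" using that by (metis dvd_diffD)
    thus ?thesis using assms by (simp add: fps_in_power_iff)
  next
    case False
    thus ?thesis using assms by (simp add: fps_in_power_iff)
  qed
  thus ?thesis unfolding fps_in_power_iff[OF a] fps_mult_nth by (auto intro!: sum.neutral)
qed

lemma poly_at_in_power:
  assumes a: "a > 0" and g: "g \<in> fps_in_power a"
  shows "poly_at p g \<in> fps_in_power a"
proof (induction p)
  case 0
  thus ?case using a by (simp add: fps_in_power_iff)
next
  case (pCons c p)
  have "g * poly_at p g \<in> fps_in_power a" by (rule fps_in_power_mult[OF a g pCons.IH])
  thus ?case using a by (auto simp: fps_in_power_iff)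
qed

lemma eval_at_in_power:
  assumes a: "a > 0" and g: "g \<in> fps_in_power a" and P: "\<And>n. \<not> a dvd n \<Longrightarrow> P $ n = 0"
  shows "eval_at P g \<in> fps_in_power a"
proof -
  have "poly_at (P $ j) g $ (n - j) = 0" if "\<not> a dvd n" "j \<le> n" for n j
  proof (cases "a dvd j")
    case True
    hence "\<not> a dvd n - j" using that by (metis dvd_diffD)
    thus ?thesis using poly_at_in_power[OF a g] a by (simp add: fps_in_power_iff)
  qed (simp add: P)
  thus ?thesis unfolding fps_in_power_iff[OF a] eval_at_nth by (auto intro!: sum.neutral)
qed

text \<open>The n-th coefficient of the iterates is constant from step n + 1 on. The second
  conclusion transfers conditions on single coefficients to the limit, such as membership in
  K[[q^a]].\<close>

lemma fps_contraction_fixpoint: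
  fixes \<Phi> :: "'a::comm_ring_1 fps \<Rightarrow> 'a fps"
  assumes contr: "\<And>g h n. (\<And>k. k < n \<Longrightarrow> g $ k = h $ k) \<Longrightarrow> \<Phi> g $ n = \<Phi> h $ n"
  obtains g where "\<Phi> g = g" and "\<And>n. \<exists>k. g $ n = (\<Phi> ^^ k) 0 $ n"
proof -
  define it where "it = (\<lambda>k. (\<Phi> ^^ k) 0)"
  have it_Suc: "it (Suc k) = \<Phi> (it k)" for k by (simp add: it_def)
  have step: "it (Suc k) $ n = it k $ n" if "n < k" for n k
    using that
  proof (induction k arbitrary: n)
    case (Suc k)
    have "\<Phi> (it (Suc k)) $ n = \<Phi> (it k) $ n" by (rule contr) (use Suc in auto)
    thus ?case by (simp only: it_Suc)
  qed simp
  have stable: "it k $ n = it (Suc n) $ n" if "n < k" for n k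
    using that
  proof (induction k)
    case (Suc k)
    thus ?case using step[of n k] by (cases "n = k") auto
  qed simp
  define g where "g = Abs_fps (\<lambda>n. it (Suc n) $ n)"
  have "\<Phi> g $ n = g $ n" for n
  proof -
    have "\<Phi> g $ n = \<Phi> (it n) $ n"
      by (rule contr, unfold g_def fps_nth_Abs_fps, rule stable[symmetric])
    thus ?thesis by (simp add: g_def it_Suc)
  qed
  hence "\<Phi> g = g" by (rule fps_ext)
  moreover have "\<exists>k. g $ n = (\<Phi> ^^ k) 0 $ n" for n
    by (intro exI[of _ "Suc n"]) (simp only: g_def it_def fps_nth_Abs_fps)
  ultimately show thesis by (rule that)
qed

text \<open>In the iteration \<open>g - P(g) / v\<close> the term \<open>v * g $ n\<close> from
  \<open>P $ 0\<close> cancels \<open>g $ n\<close>, so only lower coefficients of \<open>g\<close>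
  remain. It starts at 0 and stays in K[[q^a]].\<close>

lemma root_exists:
  fixes P :: "'a::field poly fps"
  assumes P0: "P $ 0 = [:u, v:]" and v: "v \<noteq> 0"
    and a: "a > 0" and P: "\<And>n. \<not> a dvd n \<Longrightarrow> P $ n = 0"
  obtains g where "g \<in> fps_in_power a" and "g $ 0 = - u / v" and "eval_at P g = 0"
proof -
  define \<Phi> where "\<Phi> = (\<lambda>g. g - fps_const (1 / v) * eval_at P g)"
  have head: "eval_at P g $ n = (if n = 0 then u else 0) + v * g $ n
      + (\<Sum>j = 1..n. poly_at (P $ j) g $ (n - j))" for g n
  proof -
    have "poly_at (P $ 0) g $ n = (if n = 0 then u else 0) + v * g $ n"
      by (simp add: P0 mult.commute)
    thus ?thesis by (simp add: eval_at_nth atMost_atLeast0 sum.atLeast_Suc_atMost)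
  qed
  have \<Phi>_nth: "\<Phi> g $ n = (if n = 0 then - u / v else 0)
      - (\<Sum>j = 1..n. poly_at (P $ j) g $ (n - j)) / v" for g n
    using v by (simp add: \<Phi>_def head field_simps)
  have contr: "\<Phi> g $ n = \<Phi> h $ n" if "\<And>k. k < n \<Longrightarrow> g $ k = h $ k" for g h n
  proof -
    have "(\<Sum>j = 1..n. poly_at (P $ j) g $ (n - j)) = (\<Sum>j = 1..n. poly_at (P $ j) h $ (n - j))"
      by (intro sum.cong refl poly_at_nth_cong that) auto
    thus ?thesis by (simp add: \<Phi>_nth)
  qed
  obtain g where g: "\<Phi> g = g" and lim: "\<And>n. \<exists>k. g $ n = (\<Phi> ^^ k) 0 $ n"
    using fps_contraction_fixpoint[of \<Phi>] contr by blast
  have "(\<Phi> ^^ k) 0 \<in> fps_in_power a" for k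
  proof (induction k)
    case (Suc k)
    have "eval_at P ((\<Phi> ^^ k) 0) \<in> fps_in_power a" by (rule eval_at_in_power[OF a Suc P])
    with Suc show ?case using a by (auto simp: fps_in_power_iff \<Phi>_def)
  qed (use a in \<open>simp add: fps_in_power_iff\<close>)
  hence "g \<in> fps_in_power a" using lim a unfolding fps_in_power_iff[OF a] by metis
  moreover have "g $ 0 = - u / v" using \<Phi>_nth[of g 0] by (simp add: g)
  moreover have "eval_at P g = 0" using g v by (simp add: \<Phi>_def)
  ultimately show thesis by (rule that)
qed

section \<open>Laurent series in q and their x-coefficients\<close>

text \<open>
  The library's \<open>fls_X_intpow\<close> abbreviates a shift of \<open>1\<close>, which the simplifier does not keep as a
  factor; hence a constant.
\<close>

definition qpow :: "int \<Rightarrow> 'a::comm_ring_1 fls" where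
  "qpow i = fls_X_intpow i"

lemma qpow_nth [simp]: "qpow i $$ j = (if j = i then 1 else 0)"
  by (simp add: qpow_def)

lemma qpow_times_nth [simp]: "(qpow i * P) $$ j = P $$ (j - i)"
  by (simp add: qpow_def fls_X_intpow_times_conv_shift)

lemma qpow_add: "qpow (i + j) = qpow i * qpow j"
  by (rule fls_eqI) auto

lemma qpow_0 [simp]: "qpow 0 = 1"
  by (rule fls_eqI) auto

definition x_coeff :: "nat \<Rightarrow> 'a::field poly fls \<Rightarrow> 'a fls" where
  "x_coeff k P = fls_map_coeffs (\<lambda>p. coeff p k) P"

lemma x_coeff_nth [simp]: "x_coeff k P $$ j = coeff (P $$ j) k"
  by (simp add: x_coeff_def fls_map_coeffs_nth)

lemma x_coeff_add: "x_coeff k (P + Q) = x_coeff k P + x_coeff k Q"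
  by (rule fls_eqI) simp

lemma x_coeff_diff: "x_coeff k (P - Q) = x_coeff k P - x_coeff k Q"
  by (rule fls_eqI) simp

lemma x_coeff_const_times: "x_coeff k (fls_const [:c:] * P) = fls_const c * x_coeff k P"
  by (rule fls_eqI) simp

lemma x_coeff_X_times:
  "x_coeff 0 (fls_const [:0, 1:] * P) = 0"
  "x_coeff (Suc k) (fls_const [:0, 1:] * P) = x_coeff k P"
  by (rule fls_eqI, simp)+

lemma x_coeff_fls_map_coeffs:
  "x_coeff k (fls_map_coeffs (\<lambda>c. [:c:]) g) = (if k = 0 then g else 0)"
  by (rule fls_eqI) (auto simp: fls_map_coeffs_nth coeff_pCons split: nat.splits)

lemma x_coeff_intpow: "x_coeff k (qpow i) = (if k = 0 then qpow i else 0)"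
  by (rule fls_eqI) auto

definition dil :: "'a::field fps \<Rightarrow> nat \<Rightarrow> 'a fls" where
  "dil F d = fps_to_fls (F oo fps_X ^ d)"

lemma dil_nth:
  assumes "d > 0" and "nat J \<le> L"
  shows "dil F d $$ J = (\<Sum>n\<le>L. if J = int d * int n then F $ n else 0)"
proof (cases "J \<ge> 0 \<and> int d dvd J")
  case True
  then obtain n where n: "J = int d * int n"
    using assms by (metis dvd_def nonneg_int_cases of_nat_0_less_iff zero_le_mult_iff not_le)
  have "n \<le> d * n" using assms(1) by simp
  also have "\<dots> \<le> L" using assms(2) unfolding n by (simp flip: of_nat_mult)
  finally have "n \<le> L" .
  have "(\<Sum>i\<le>L. if J = int d * int i then F $ i else 0) = (\<Sum>i\<le>L. if i = n then F $ i else 0)"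
    using assms(1) by (intro sum.cong) (auto simp: n)
  also have "\<dots> = F $ n" using \<open>n \<le> L\<close> by simp
  finally show ?thesis
    using assms(1) by (simp add: dil_def n fps_nth_compose_X_power flip: of_nat_mult)
next
  case False
  hence "(\<Sum>n\<le>L. if J = int d * int n then F $ n else 0) = 0"
    by (intro sum.neutral) auto
  moreover have "\<not> d dvd nat J" if "J \<ge> 0"
    using False that by (metis int_dvd_int_iff nat_0_le)
  hence "dil F d $$ J = 0"
    using assms(1) by (simp add: dil_def fps_nth_compose_X_power)
  ultimately show ?thesis by simp
qed

section \<open>The common form of N and M\<close>

text \<open>\<open>N\<close> and \<open>M\<close> are the cases \<open>b = 1\<close> and \<open>b = a\<close> of one series \<open>W_series a b F\<close>.\<close>

definition W_tail :: "nat \<Rightarrow> nat \<Rightarrow> 'a::field fps \<Rightarrow> 'a poly fls" where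
  "W_tail a b F = (\<Sum>\<^sub>\<infinity>n\<in>{2..}. fls_const [:F $ n:] *
     (qpow (int b * int n - int a) * (qpow (int a * int n) - 1)
       * fls_geometric (fls_const [:0, 1:] * qpow (int a * (int n - 1)))))"

definition W_series :: "nat \<Rightarrow> nat \<Rightarrow> 'a::field fps \<Rightarrow> 'a poly fls" where
  "W_series a b F =
     (1 - fls_const [:0, 1:]) * fls_map_coeffs (\<lambda>c. [:c:]) (dil F b)
     + fls_const [:F $ 1:] * fls_const [:0, 1:] * (qpow (int b) - qpow (int b - int a))
     + fls_const [:0, 1:] * (1 - fls_const [:0, 1:]) * W_tail a b F"

lemma M_series_eq: "M_series a F = W_series a a F"
  by (simp add: M_series_def W_series_def W_tail_def dil_def Let_def qpow_def right_diff_distrib)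

lemma N_series_eq: "N_series a F = W_series a 1 F"
  by (simp add: N_series_def W_series_def W_tail_def dil_def Let_def qpow_def)

lemma coeff_X_power: "coeff ([:0, 1:] ^ m) k = (if m = k then 1 else 0 :: 'a::comm_ring_1)"
  using coeff_monom[of "1 :: 'a" m k] by (simp add: monom_altdef)

lemma coeff_geometric:
  assumes "d > 0"
  shows "coeff (fls_geometric (fls_const [:0, 1:] * qpow d) $$ j) k =
           (if j = d * int k then 1 else 0 :: 'a::field)"
  unfolding qpow_def fls_geometric_monom_nth[OF assms]
  using assms by (auto simp: coeff_X_power pos_imp_zdiv_nonneg_iff)

text \<open>The \<open>x^k\<close>-part of the n-th term is
  \<open>f_n (q^(b n + a n) - q^(b n)) q^(a (n - 1) k - a)\<close>; adding \<open>a (k + 1)\<close>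
  to the exponents gives \<open>(b + a (k + 1)) n\<close> and \<open>(b + a k) n\<close>.\<close>

lemma coeff_W_tail:
  assumes "a \<ge> 1" "b \<ge> 1" and L: "nat (j + int a) \<le> L"
  shows "coeff (W_tail a b F $$ j) k =
    (\<Sum>n=2..L. F $ n * ((if j + int (a * Suc k) = int (b + a * Suc k) * int n then 1 else 0)
                    - (if j + int (a * Suc k) = int (b + a * k) * int n then 1 else 0)))"
proof -
  define T :: "nat \<Rightarrow> 'a poly fls" where "T = (\<lambda>n. fls_const [:F $ n:] *
     (qpow (int b * int n - int a) * (qpow (int a * int n) - 1)
       * fls_geometric (fls_const [:0, 1:] * qpow (int a * (int n - 1)))))"
  have T: "coeff (T n $$ j) k = F $ n * 
       ((if j + int (a * Suc k) = int (b + a * Suc k) * int n then 1 else 0)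
                    - (if j + int (a * Suc k) = int (b + a * k) * int n then 1 else 0))"
    if "n \<ge> 2" for n j k
  proof -
    define e where "e = int b * int n - int a"
    define d where "d = int a * (int n - 1)"
    have d: "d > 0" using that assms(1) by (simp add: d_def)
    define G where "G = fls_geometric (fls_const [:0, 1:: 'a:] * qpow d)"
    have "T n = fls_const [:F $ n:] * (qpow (e + int a * int n) * G - qpow e * G)"
      unfolding T_def e_def[symmetric] d_def[symmetric] G_def[symmetric] qpow_add[of e]
      by (simp add: algebra_simps)
    hence "T n $$ j = [:F $ n:] * (G $$ (j - (e + int a * int n)) - G $$ (j - e))"
      by (simp add: )
    hence "coeff (T n $$ j) k = F $ n * ((if j - (e + int a * int n) = d * int k then 1 else 0)
                    - (if j - e = d * int k then 1 else 0))"
      by (simp add: G_def coeff_geometric[OF d])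
    moreover have "j - (e + int a * int n) = d * int k \<longleftrightarrow>
        j + int (a * Suc k) = int (b + a * Suc k) * int n"
      "j - e = d * int k \<longleftrightarrow> j + int (a * Suc k) = int (b + a * k) * int n"
      by (auto simp: e_def d_def algebra_simps)
    ultimately show ?thesis by simp
  qed
  \<comment> \<open>Since \<open>b n >= n\<close> and \<open>a k n >= a k\<close>, even the lower
    exponent forces \<open>n <= j + a\<close>; this yields both summability and the finite
    range.\<close>
  have low: "n \<le> nat (j + int a)" if n: "n \<ge> 2" and nz: "T n $$ j \<noteq> 0" for n j
  proof -
    obtain k where "coeff (T n $$ j) k \<noteq> 0" using nz by (auto simp: poly_eq_iff)
    hence "int (b + a * k) * int n \<le> j + int (a * Suc k)"
      unfolding T[OF n] by (auto split: if_splits simp: algebra_simps)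
    moreover have "int (a * k) * int n \<ge> int (a * k) * 1"
      using n by (intro mult_left_mono) auto
    moreover have "int b * int n \<ge> 1 * int n" using assms(2) by (intro mult_right_mono) auto
    ultimately show ?thesis by (simp add: algebra_simps)
  qed
  have fin: "finite {n \<in> {2..}. \<exists>j\<le>J. T n $$ j \<noteq> 0}" for J
  proof (rule finite_subset)
    show "{n \<in> {2..}. \<exists>j\<le>J. T n $$ j \<noteq> 0} \<subseteq> {..nat (J + int a)}"
    proof
      fix n assume "n \<in> {n \<in> {2..}. \<exists>j\<le>J. T n $$ j \<noteq> 0}"
      then obtain j where "n \<ge> 2" "j \<le> J" "T n $$ j \<noteq> 0" by auto
      from low[OF this(1,3)] this(2) show "n \<in> {..nat (J + int a)}" by simp
    qed
  qed simp
  have "W_tail a b F $$ j = (\<Sum>n | n \<in> {2..} \<and> T n $$ j \<noteq> 0. T n $$ j)"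
    unfolding W_tail_def T_def[symmetric] by (rule fls_has_sum(2)[OF fin])
  also have "\<dots> = (\<Sum>n=2..L. T n $$ j)"
    using order_trans[OF low L] by (intro sum.mono_neutral_left) auto
  finally have "coeff (W_tail a b F $$ j) k = (\<Sum>n=2..L. coeff (T n $$ j) k)"
    by (simp add: coeff_sum)
  also have "\<dots> = (\<Sum>n=2..L. F $ n *
      ((if j + int (a * Suc k) = int (b + a * Suc k) * int n then 1 else 0)
        - (if j + int (a * Suc k) = int (b + a * k) * int n then 1 else 0)))"
    by (intro sum.cong refl T) simp
  finally show ?thesis .
qed

text \<open>
  The \<open>x\<^sup>k\<close>-coefficient of \<open>(1 - q\<^sup>-\<^sup>a x) \<Sum>\<^sub>m q\<^sup>-\<^sup>a\<^sup>m F(q\<^sup>a\<^sup>m\<^sup>+\<^sup>b) x\<^sup>m\<close>, which equals \<open>W_series a b F / (1 - x)\<close>.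
\<close>

definition Z_coeff :: "nat \<Rightarrow> nat \<Rightarrow> 'a::field fps \<Rightarrow> nat \<Rightarrow> 'a fls" where
  "Z_coeff a b F k = (case k of 0 \<Rightarrow> dil F b | Suc k \<Rightarrow>
     qpow (- int (a * Suc k)) * (dil F (b + a * Suc k) - dil F (b + a * k)))"

text \<open>Extended to all n >= 0, the sum is the difference of dilations in
  \<open>Z_coeff\<close>. The n = 0 terms cancel, and the n = 1 terms are the subtracted
  \<open>f_1 (q^b - q^(b-a))\<close>.\<close>

lemma x_coeff_W_tail:
  assumes "a \<ge> 1" "b \<ge> 1"
  shows "x_coeff k (W_tail a b F) = Z_coeff a b F (Suc k) -
           fls_const (F $ 1) * (qpow (int b) - qpow (int b - int a))"
proof (rule fls_eqI)
  fix j
  define J where "J = j + int (a * Suc k)"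
  define L where "L = Suc (Suc (max (nat (j + int a)) (nat J)))"
  have ge: "nat (j + int a) \<le> L" "nat J \<le> L" by (auto simp: L_def)
  have dil: "dil F d $$ J = (if J = 0 then F $ 0 else 0) + (if J = int d then F $ 1 else 0)
      + (\<Sum>n=2..L. if J = int d * int n then F $ n else 0)" if "d > 0" for d
  proof -
    have "{..L} = insert 0 (insert 1 {2..L})" by (auto simp: L_def)
    hence "(\<Sum>n\<le>L. if J = int d * int n then F $ n else 0) =
       (\<Sum>n\<in>insert 0 (insert 1 {2..L}). if J = int d * int n then F $ n else 0)"
      by (simp only:)
    also have "\<dots> = (if J = 0 then F $ 0 else 0) + ((if J = int d then F $ 1 else 0)
      + (\<Sum>n=2..L. if J = int d * int n then F $ n else 0))"
      by (subst sum.insert, simp, simp, subst sum.insert, simp, simp) simp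
    finally show ?thesis
      by (simp add: dil_nth[OF that ge(2)] add.assoc)
  qed
  have Z: "Z_coeff a b F (Suc k) $$ j = dil F (b + a * Suc k) $$ J - dil F (b + a * k) $$ J"
    by (simp only: Z_coeff_def nat.case qpow_times_nth fls_minus_nth diff_minus_eq_add J_def)
  have J: "J = int (b + a * Suc k) \<longleftrightarrow> j = int b" "J = int (b + a * k) \<longleftrightarrow> j = int b - int a"
    by (auto simp: J_def algebra_simps)
  have "x_coeff k (W_tail a b F) $$ j = 
     (\<Sum>n=2..L. F $ n * ((if J = int (b + a * Suc k) * int n then 1 else 0)
                    - (if J = int (b + a * k) * int n then 1 else 0)))"
    by (simp only: x_coeff_nth coeff_W_tail[OF assms ge(1)] J_def)
  also have "\<dots> = (\<Sum>n=2..L. if J = int (b + a * Suc k) * int n then F $ n else 0)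
     - (\<Sum>n=2..L. if J = int (b + a * k) * int n then F $ n else 0)"
    unfolding sum_subtractf[symmetric] by (rule sum.cong) auto
  also have "\<dots> = Z_coeff a b F (Suc k) $$ j -
     ((if j = int b then F $ 1 else 0) - (if j = int b - int a then F $ 1 else 0))"
    unfolding Z using assms by (simp add: dil J del: mult_Suc_right of_nat_add of_nat_mult)
  also have "\<dots> = (Z_coeff a b F (Suc k) -
           fls_const (F $ 1) * (qpow (int b) - qpow (int b - int a))) $$ j"
    by simp
  finally show "x_coeff k (W_tail a b F) $$ j = (Z_coeff a b F (Suc k) -
           fls_const (F $ 1) * (qpow (int b) - qpow (int b - int a))) $$ j" .
qed

text \<open>The correction \<open>f_1 (q^b - q^(b-a))\<close> occurs in every x-coefficient of the
  tail, so it sums to a multiple of 1/(1 - x); times x (1 - x) it cancels the explicit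
  f_1-term.\<close>

lemma x_coeff_W_series:
  assumes "a \<ge> 1" "b \<ge> 1"
  shows "x_coeff 0 (W_series a b F) = Z_coeff a b F 0"
    and "x_coeff (Suc k) (W_series a b F) = Z_coeff a b F (Suc k) - Z_coeff a b F k"
proof -
  define x :: "'a poly fls" where "x = fls_const [:0, 1:]"
  define G where "G = fls_map_coeffs (\<lambda>c. [:c:]) (dil F b)"
  define D :: "'a poly fls" where "D = qpow (int b) - qpow (int b - int a)"
  define S where "S = W_tail a b F"
  have W: "W_series a b F = G - x * G + fls_const [:F $ 1:] * (x * D) + x * S - x * (x * S)"
    unfolding W_series_def x_def[symmetric] G_def[symmetric] D_def[symmetric] S_def[symmetric]
    by (simp add: algebra_simps)
  have x0: "x_coeff 0 (x * P) = 0" and xS: "x_coeff (Suc k) (x * P) = x_coeff k P" for P k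
    unfolding x_def by (rule x_coeff_X_times)+
  have G: "x_coeff k G = (if k = 0 then dil F b else 0)" for k
    by (simp add: G_def x_coeff_fls_map_coeffs)
  have D: "x_coeff k D = (if k = 0 then qpow (int b) - qpow (int b - int a) else 0)"
    for k unfolding D_def x_coeff_diff x_coeff_intpow by simp
  have S: "x_coeff k S = Z_coeff a b F (Suc k) -
      fls_const (F $ 1) * (qpow (int b) - qpow (int b - int a))" for k
    unfolding S_def by (rule x_coeff_W_tail[OF assms])
  show "x_coeff 0 (W_series a b F) = Z_coeff a b F 0"
    unfolding W by (simp add: x_coeff_add x_coeff_diff x_coeff_const_times x0 G Z_coeff_def)
  show "x_coeff (Suc k) (W_series a b F) = Z_coeff a b F (Suc k) - Z_coeff a b F k"
    unfolding W by (cases k) (simp_all add: x_coeff_add x_coeff_diff x_coeff_const_times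
        x0 xS G D S, simp_all add: Z_coeff_def)
qed

section \<open>Orders, supports and lowest coefficients of M and N\<close>

text \<open>The least possible exponent belongs to n = 2 and the lower term:
  \<open>2 (b + a k) - a (k + 1)\<close>. Its growth in k is the source of the degree
  bounds.\<close>

lemma W_tail_order:
  assumes "a \<ge> 1" "b \<ge> 1" and nz: "x_coeff k (W_tail a b F) $$ j \<noteq> 0"
  shows "2 * int b + int a * int k - int a \<le> j"
proof -
  let ?L = "nat (j + int a)"
  have "(\<Sum>n=2..?L. F $ n * ((if j + int (a * Suc k) = int (b + a * Suc k) * int n then 1 else 0)
        - (if j + int (a * Suc k) = int (b + a * k) * int n then 1 else 0))) \<noteq> 0"
    using nz unfolding x_coeff_nth coeff_W_tail[OF assms(1,2) order_refl] .
  then obtain n where n: "n \<ge> 2" and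
    "(if j + int (a * Suc k) = int (b + a * Suc k) * int n then 1 else 0)
        - (if j + int (a * Suc k) = int (b + a * k) * int n then 1 else 0) \<noteq> (0 :: 'a)"
    by (metis (no_types, lifting) sum.neutral atLeastAtMost_iff mult_zero_right)
  hence "int (b + a * k) * int n \<le> j + int (a * Suc k)"
    by (auto split: if_splits simp: algebra_simps)
  moreover have "int (b + a * k) * 2 \<le> int (b + a * k) * int n"
    using n by (intro mult_left_mono) auto
  ultimately show ?thesis by (simp add: algebra_simps)
qed

text \<open>Every \<open>Z_coeff a b F (Suc k)\<close> carries the same f_1-term, whatever k is.
  From \<open>x^2\<close> on it cancels in the differences, leaving tails whose order grows.\<close>

lemma x_coeff_W_series_tail:
  assumes "a \<ge> 1" "b \<ge> 1"
  shows "x_coeff 1 (W_series a b F) =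
           fls_const (F $ 1) * (qpow (int b) - qpow (int b - int a))
           - dil F b + x_coeff 0 (W_tail a b F)"
    and "x_coeff (Suc (Suc k)) (W_series a b F) =
           x_coeff (Suc k) (W_tail a b F) - x_coeff k (W_tail a b F)"
  unfolding One_nat_def x_coeff_W_series[OF assms] x_coeff_W_tail[OF assms]
  by (simp_all add: Z_coeff_def)

text \<open>The second bound, read backwards, limits the x-degree of each q-coefficient.\<close>

lemma W_series_order:
  assumes "a \<ge> 1" "b \<ge> 1" "b \<le> a" and nz: "coeff (W_series a b F $$ j) i \<noteq> 0"
  shows "int b - int a \<le> j" and "i \<ge> 2 \<Longrightarrow> 2 * int b + int a * int (i - 2) - int a \<le> j"
proof -
  have dil: "dil F b $$ j = 0" if "j < 0"
    using that by (simp add: dil_def)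
  have tail: "x_coeff k (W_tail a b F) $$ j = 0" if "j < 2 * int b + int a * int k - int a" for k
    using that W_tail_order[OF assms(1,2), of k F j] by linarith
  have pos: "int a * int k \<ge> 0" for k by simp
  have nz': "x_coeff i (W_series a b F) $$ j \<noteq> 0" using nz by simp
  show 2: "2 * int b + int a * int (i - 2) - int a \<le> j" if "i \<ge> 2"
  proof (rule ccontr)
    assume neg: "\<not> ?thesis"
    have "i = Suc (Suc (i - 2))" using that by simp
    then obtain k where i: "i = Suc (Suc k)" by blast
    have "j < 2 * int b + int a * int (Suc k) - int a" using neg i by (simp add: algebra_simps)
    moreover have "j < 2 * int b + int a * int k - int a" using neg i by simp
    ultimately show False
      using nz' tail[of "Suc k"] tail[of k]
      unfolding i x_coeff_W_series_tail(2)[OF assms(1,2)] by simp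
  qed
  show "int b - int a \<le> j"
  proof (rule ccontr)
    assume neg: "\<not> ?thesis"
    consider "i = 0" | "i = 1" | "i \<ge> 2" by linarith
    thus False
    proof cases
      case 1
      thus False using nz' neg assms(3) dil unfolding 1 x_coeff_W_series(1)[OF assms(1,2)]
        by (simp add: Z_coeff_def)
    next
      case 2
      thus False using nz' neg assms(3) dil tail[of 0]
        unfolding 2 x_coeff_W_series_tail(1)[OF assms(1,2)] by simp
    next
      case 3
      thus False using 2 neg pos[of "i - 2"] by linarith
    qed
  qed
qed

lemma M_series_support:
  assumes "a \<ge> 1" and "\<not> int a dvd j"
  shows "M_series a F $$ j = 0"
proof (rule poly_eqI)
  fix i
  have dil: "dil F (a * d) $$ J = 0" if "\<not> int a dvd J" "d \<ge> 1" for d J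
    using that assms(1) by (auto simp: dil_nth[OF _ order_refl] intro!: sum.neutral)
  have Z: "Z_coeff a a F k $$ j = 0" for k
  proof (cases k)
    case 0
    thus ?thesis using dil[OF assms(2), of 1] by (simp add: Z_coeff_def)
  next
    case (Suc l)
    have "\<not> int a dvd j + int (a * Suc l)"
      using assms(2) by (simp add: dvd_add_left_iff del: mult_Suc_right)
    from dil[OF this, of "Suc (Suc l)"] dil[OF this, of "Suc l"] show ?thesis
      unfolding Suc Z_coeff_def nat.case qpow_times_nth fls_minus_nth diff_minus_eq_add by simp
  qed
  show "coeff (M_series a F $$ j) i = coeff 0 i"
    using x_coeff_W_series[OF assms(1,1), where F = F] Z unfolding M_series_eq x_coeff_nth[symmetric]
    by (cases i) simp_all
qed

text \<open>The tail has order at least \<open>a\<close>, so at \<open>q^0\<close> only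
  \<open>(1 - x) F(0)\<close> and \<open>- f_1 x\<close> contribute.\<close>

lemma M_series_0:
  assumes "a \<ge> 1" "F $ 0 = 1"
  shows "M_series a F $$ 0 = [:1, - (1 + F $ 1):]"
proof (rule poly_eqI)
  fix i
  have tail: "x_coeff k (W_tail a a F) $$ 0 = 0" for k
  proof (rule ccontr)
    assume "\<not> ?thesis"
    from W_tail_order[OF assms(1,1) this] have "int a + int a * int k \<le> 0" by simp
    moreover have "int a * int k \<ge> 0" by simp
    ultimately show False using assms(1) by linarith
  qed
  have dil: "dil F a $$ 0 = 1" using assms by (simp add: dil_def)
  consider "i = 0" | "i = 1" | k where "i = Suc (Suc k)"
    by (metis One_nat_def old.nat.exhaust)
  thus "coeff (M_series a F $$ 0) i = coeff [:1, - (1 + F $ 1):] i"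
    unfolding M_series_eq x_coeff_nth[symmetric]
  proof cases
    case 1
    show "x_coeff i (W_series a a F) $$ 0 = coeff [:1, - (1 + F $ 1):] i"
      unfolding 1 x_coeff_W_series(1)[OF assms(1,1)] by (simp add: Z_coeff_def dil)
  next
    case 2
    show "x_coeff i (W_series a a F) $$ 0 = coeff [:1, - (1 + F $ 1):] i"
      unfolding 2 x_coeff_W_series_tail(1)[OF assms(1,1)] using assms(1) tail[of 0] by (simp add: dil)
  next
    case 3
    show "x_coeff i (W_series a a F) $$ 0 = coeff [:1, - (1 + F $ 1):] i"
      unfolding 3 x_coeff_W_series_tail(2)[OF assms(1,1)] using tail by simp
  qed
qed

text \<open>The tail starts no earlier than \<open>q^(2 - a)\<close>, and \<open>1 - a\<close> is
  negative, so F(q) does not contribute; the f_1-term remains.\<close>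

lemma N_series_lowest:
  assumes "a \<ge> 2"
  shows "N_series a F $$ (1 - int a) = [:0, - F $ 1:]"
proof (rule poly_eqI)
  fix i
  have a: "a \<ge> 1" using assms by simp
  have tail: "x_coeff k (W_tail a 1 F) $$ (1 - int a) = 0" for k
  proof (rule ccontr)
    assume "\<not> ?thesis"
    from W_tail_order[OF a order_refl this] have "1 + int a * int k \<le> 0" by simp
    moreover have "int a * int k \<ge> 0" by simp
    ultimately show False by linarith
  qed
  have dil: "dil F 1 $$ (1 - int a) = 0" using assms by (simp add: dil_def)
  consider "i = 0" | "i = 1" | k where "i = Suc (Suc k)"
    by (metis One_nat_def old.nat.exhaust)
  thus "coeff (N_series a F $$ (1 - int a)) i = coeff [:0, - F $ 1:] i"
    unfolding N_series_eq x_coeff_nth[symmetric]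
  proof cases
    case 1
    show "x_coeff i (W_series a 1 F) $$ (1 - int a) = coeff [:0, - F $ 1:] i"
      unfolding 1 x_coeff_W_series(1)[OF a order_refl] using dil by (simp add: Z_coeff_def)
  next
    case 2
    show "x_coeff i (W_series a 1 F) $$ (1 - int a) = coeff [:0, - F $ 1:] i"
      unfolding 2 x_coeff_W_series_tail(1)[OF a order_refl] using assms tail[of 0] dil by simp
  next
    case 3
    show "x_coeff i (W_series a 1 F) $$ (1 - int a) = coeff [:0, - F $ 1:] i"
      unfolding 3 x_coeff_W_series_tail(2)[OF a order_refl] using tail by simp
  qed
qed

section \<open>Expansion in K((q))[[x]] and the relation R M = N\<close>

definition x_expand :: "'a::field poly fls \<Rightarrow> 'a fls fps" where
  "x_expand P = Abs_fps (\<lambda>k. x_coeff k P)"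

text \<open>The substitution \<open>X = x/q\<^sup>a\<close>.\<close>

definition q_rescale :: "nat \<Rightarrow> 'a::field fps fps \<Rightarrow> 'a fls fps" where
  "q_rescale a P = Abs_fps (\<lambda>m. qpow (- int (a * m)) * fps_to_fls (P $ m))"

lemma fps_to_fls_sum: "fps_to_fls (\<Sum>i\<in>A. f i) = (\<Sum>i\<in>A. fps_to_fls (f i))"
  by (induction A rule: infinite_finite_induct) simp_all

lemma q_rescale_mult: "q_rescale a (P * Q) = q_rescale a P * q_rescale a Q"
proof (rule fps_ext)
  fix m
  have eq: "qpow (- int (a * m)) * (fps_to_fls (P $ i) * fps_to_fls (Q $ (m - i))) =
     qpow (- int (a * i)) * fps_to_fls (P $ i) *
     (qpow (- int (a * (m - i))) * fps_to_fls (Q $ (m - i)))" if "i \<le> m" for i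
  proof -
    have "(qpow (- int (a * m)) :: 'a fls) =
       qpow (- int (a * i)) * qpow (- int (a * (m - i)))"
      using that by (simp add: qpow_add[symmetric] diff_mult_distrib2 of_nat_diff)
    thus ?thesis by (simp only: mult_ac)
  qed
  show "q_rescale a (P * Q) $ m = (q_rescale a P * q_rescale a Q) $ m"
    unfolding q_rescale_def fps_mult_nth fps_nth_Abs_fps fps_to_fls_sum fls_times_fps_to_fls
      sum_distrib_left
    by (intro sum.cong refl eq) simp
qed

text \<open>Multiplication by \<open>1 - q^(-a) x\<close> turns the dilations into the differences
  of \<open>Z_coeff\<close>; the factor \<open>1 - x\<close> is the one found in
  \<open>x_coeff_W_series\<close>.\<close>

lemma x_expand_W_series:
  assumes "a \<ge> 1" "b \<ge> 1"
  shows "x_expand (W_series a b F) =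
    (1 - fps_X) * ((1 - fps_const (qpow (- int a)) * fps_X) *
       q_rescale a (Abs_fps (\<lambda>m. F oo fps_X ^ (a * m + b))))"
proof -
  define A where "A = q_rescale a (Abs_fps (\<lambda>m. F oo fps_X ^ (a * m + b)))"
  have A: "A $ m = qpow (- int (a * m)) * dil F (b + a * m)" for m
    by (simp add: A_def q_rescale_def dil_def add.commute)
  have "(1 - fps_const (qpow (- int a)) * fps_X) * A = Abs_fps (Z_coeff a b F)"
  proof (rule fps_ext)
    fix m
    have "((1 - fps_const (qpow (- int a)) * fps_X) * A) =
       A - fps_const (qpow (- int a)) * (fps_X * A)"
      by (simp add: algebra_simps)
    moreover have eq: "qpow (- int a) * (qpow (- int (a * k)) * P) =
        qpow (- int (a * Suc k)) * P" for k and P :: "'a fls"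
      unfolding mult.assoc[symmetric] qpow_add[symmetric] by (simp add: algebra_simps)
    ultimately show "((1 - fps_const (qpow (- int a)) * fps_X) * A) $ m = 
        Abs_fps (Z_coeff a b F) $ m"
      by (cases m) (simp_all add: A Z_coeff_def eq right_diff_distrib del: of_nat_mult mult_Suc_right)
  qed
  moreover have "x_expand (W_series a b F) = (1 - fps_X) * Abs_fps (Z_coeff a b F)"
  proof (rule fps_ext)
    fix m
    have "(1 - fps_X) * Abs_fps (Z_coeff a b F) = Abs_fps (Z_coeff a b F) -
        fps_X * Abs_fps (Z_coeff a b F)" by (simp add: algebra_simps)
    thus "x_expand (W_series a b F) $ m = ((1 - fps_X) * Abs_fps (Z_coeff a b F)) $ m"
      by (cases m) (simp_all add: x_expand_def x_coeff_W_series[OF assms])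
  qed
  ultimately show ?thesis by (simp add: A_def)
qed

lemma R_series_M_N:
  assumes "a \<ge> 1" "F $ 0 = 1"
  shows "q_rescale a (R_series a F) * x_expand (M_series a F) = x_expand (N_series a F)"
proof -
  have "q_rescale a (R_series a F) * q_rescale a (Abs_fps (\<lambda>m. F oo fps_X ^ (a * m + a))) =
      q_rescale a (Abs_fps (\<lambda>m. F oo fps_X ^ (a * m + 1)))"
    using R_series_mult[OF assms(2), of a] by (simp add: add.commute flip: q_rescale_mult)
  thus ?thesis
    unfolding M_series_eq N_series_eq x_expand_W_series[OF assms(1,1)]
      x_expand_W_series[OF assms(1) order_refl]
    by (metis (no_types, lifting) mult.left_commute)
qed

section \<open>Evaluation of Laurent series and the x-derivative\<close>

text \<open>The bridge from \<open>fls_eval\<close> to \<open>eval_at\<close>, for which the ring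
  laws are proved.\<close>

lemma fls_eval_qpow_times:
  "fls_eval (qpow k * fps_to_fls P) g = qpow k * fps_to_fls (eval_at P g)"
proof (rule fls_eqI)
  fix n
  define Q where "Q = qpow k * fps_to_fls P"
  define f where "f = (\<lambda>j. poly_at (Q $$ j) g $ nat (n - j))"
  have below: "f j = 0" if "j < k" for j
    using that by (simp add: f_def Q_def)
  have "fls_eval Q g $$ n = sum f {fls_subdegree Q..n}"
    by (simp add: fls_eval_nth f_def poly_at_def)
  \<comment> \<open>The subdegree of \<open>Q\<close> exceeds k when \<open>P $ 0 = 0\<close> but
    \<open>P\<close> is nonzero and k >= 0, and is 0 by convention when \<open>Q = 0\<close>; the
    minimum covers every order of the two bounds.\<close>
  also have "\<dots> = sum f {min k (fls_subdegree Q)..n}"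
    by (rule sum.mono_neutral_left) (auto simp: f_def)
  also have "\<dots> = sum f {k..n}"
    by (rule sum.mono_neutral_right) (auto simp: below)
  also have "\<dots> = (qpow k * fps_to_fls (eval_at P g)) $$ n"
  proof (cases "k \<le> n")
    case True
    have "sum f {k..n} = (\<Sum>i\<le>nat (n - k). poly_at (P $ i) g $ (nat (n - k) - i))"
      using True
      by (intro sum.reindex_bij_witness[where i = "\<lambda>i. k + int i" and j = "\<lambda>j. nat (j - k)"])
        (auto simp: f_def Q_def intro!: arg_cong2[of _ _ _ _ "($)"])
    thus ?thesis using True by (simp add: eval_at_nth)
  qed simp
  finally show "fls_eval (qpow k * fps_to_fls P) g $$ n = (qpow k * fps_to_fls (eval_at P g)) $$ n"
    by (simp add: Q_def)
qed

lemma fls_eval_fps_to_fls: "fls_eval (fps_to_fls P) g = fps_to_fls (eval_at P g)"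
  using fls_eval_qpow_times[of 0 P g] by simp

definition pderiv_fps :: "'a::field poly fps \<Rightarrow> 'a poly fps" where
  "pderiv_fps P = Abs_fps (\<lambda>n. pderiv (P $ n))"

lemma pderiv_fps_mult: "pderiv_fps (P * Q) = pderiv_fps P * Q + P * pderiv_fps Q"
  by (rule fps_ext)
    (simp add: pderiv_fps_def fps_mult_nth higher_pderiv_sum[where n = 1, simplified]
      pderiv_mult sum.distrib, simp add: mult.commute add.commute)

lemma pderiv_fps_root_factor: "pderiv_fps (root_factor g) = - 1"
  by (rule fps_ext) (simp add: pderiv_fps_def root_factor_def pderiv_diff pderiv_pCons one_pCons)

lemma fls_map_coeffs_pderiv: "fls_map_coeffs pderiv (fps_to_fls P) = fps_to_fls (pderiv_fps P)"
  by (rule fls_eqI) (simp add: fls_map_coeffs_nth pderiv_fps_def)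

text \<open>In the product rule the term with the factor g - x vanishes at x = g. Applied to M, this
  gives M_x(x_0) = - H(x_0).\<close>

lemma eval_at_pderiv_root:
  "eval_at (pderiv_fps (root_factor g * Q)) g = - eval_at Q g"
proof -
  have "pderiv_fps (root_factor g * Q) = root_factor g * pderiv_fps Q - Q"
    by (simp add: pderiv_fps_mult pderiv_fps_root_factor)
  thus ?thesis by (simp add: eval_at_diff eval_at_mult eval_at_root_factor)
qed

section \<open>Compatibility of the x-expansion with ring operations\<close>

lemma x_coeff_fps_to_fls: "x_coeff k (fps_to_fls P) = fps_to_fls (Abs_fps (\<lambda>j. coeff (P $ j) k))"
  by (rule fls_eqI) simp

lemma x_expand_mult:
  "x_expand (fps_to_fls (P * Q)) = x_expand (fps_to_fls P) * x_expand (fps_to_fls Q)"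
proof (rule fps_ext)
  fix m
  have "Abs_fps (\<lambda>j. coeff ((P * Q) $ j) m) =
      (\<Sum>i=0..m. Abs_fps (\<lambda>j. coeff (P $ j) i) * Abs_fps (\<lambda>j. coeff (Q $ j) (m - i)))"
  proof (rule fps_ext)
    fix j
    have "coeff ((P * Q) $ j) m =
        (\<Sum>s=0..j. \<Sum>i=0..m. coeff (P $ s) i * coeff (Q $ (j - s)) (m - i))"
      by (simp add: fps_mult_nth coeff_sum coeff_mult atMost_atLeast0)
    also have "\<dots> = (\<Sum>i=0..m. \<Sum>s=0..j. coeff (P $ s) i * coeff (Q $ (j - s)) (m - i))"
      by (rule sum.swap)
    finally show "Abs_fps (\<lambda>j. coeff ((P * Q) $ j) m) $ j =
        (\<Sum>i=0..m. Abs_fps (\<lambda>j. coeff (P $ j) i) * Abs_fps (\<lambda>j. coeff (Q $ j) (m - i))) $ j"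
      by (simp add: fps_sum_nth fps_mult_nth)
  qed
  thus "x_expand (fps_to_fls (P * Q)) $ m =
      (x_expand (fps_to_fls P) * x_expand (fps_to_fls Q)) $ m"
    unfolding x_expand_def x_coeff_fps_to_fls fps_mult_nth fps_nth_Abs_fps
    by (simp only: fps_to_fls_sum fls_times_fps_to_fls)
qed

lemma x_expand_diff: "x_expand (P - Q) = x_expand P - x_expand Q"
  by (rule fps_ext) (simp add: x_expand_def x_coeff_diff)

lemma x_expand_qpow_times: "x_expand (qpow k * P) = fps_const (qpow k) * x_expand P"
  by (rule fps_ext, rule fls_eqI) (simp add: x_expand_def)

lemma x_expand_fps_of_coeffs: "x_expand (fps_to_fls (fps_of_coeffs g)) = fps_const (fps_to_fls g)"
  by (rule fps_ext, rule fls_eqI) (auto simp: x_expand_def coeff_pCons split: nat.splits)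

lemma x_expand_root_factor:
  "x_expand (fps_to_fls (root_factor g)) = fps_const (fps_to_fls g) - fps_X"
proof -
  have "x_expand (fps_to_fls (fps_const [:0, 1 :: 'a:])) = fps_X"
    by (rule fps_ext, rule fls_eqI)
      (auto simp: x_expand_def coeff_pCons fps_X_def split: nat.splits)
  thus ?thesis by (simp add: root_factor_def x_expand_diff x_expand_fps_of_coeffs)
qed

section \<open>Degree bounds\<close>

lemma degree_fps_mult_nth_le:
  assumes "\<And>n. degree (P $ n) \<le> u n" "\<And>n. degree (Q $ n) \<le> v n"
    and "\<And>i j. i + j = n \<Longrightarrow> u i + v j \<le> w"
  shows "degree ((P * Q) $ n) \<le> w"
  unfolding fps_mult_nth
proof (intro degree_sum_le)
  fix i assume "i \<in> {0..n}"
  hence "u i + v (n - i) \<le> w" by (intro assms(3)) simp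
  moreover have "degree (P $ i * Q $ (n - i)) \<le> degree (P $ i) + degree (Q $ (n - i))"
    by (rule degree_mult_le)
  ultimately show "degree (P $ i * Q $ (n - i)) \<le> w"
    using assms(1)[of i] assms(2)[of "n - i"] by linarith
qed simp

text \<open>As \<open>H $ 0\<close> is a nonzero constant, the recursion for \<open>U $ n\<close>
  divides only by a scalar, and superadditivity of \<open>w\<close> carries the bound along.\<close>

lemma fps_inverse_degree_le:
  fixes H :: "'a::field poly fps"
  assumes H0: "H $ 0 = [:h:]" "h \<noteq> 0"
    and deg: "\<And>n. degree (H $ n) \<le> w n"
    and super: "\<And>i j. w i + w j \<le> w (i + j)"
  obtains U where "H * U = 1" and "\<And>n. degree (U $ n) \<le> w n"
proof -
  \<comment> \<open>K[x] is not a field, so the inverse of the lowest coefficient is supplied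
    explicitly.\<close>
  define U where "U = fps_right_inverse H [:1 / h:]"
  have HU: "H * U = 1"
    unfolding U_def using H0 by (intro fps_right_inverse) (simp add: one_pCons)
  have "degree (U $ n) \<le> w n" for n
  proof (induction n rule: less_induct)
    case (less n)
    define S where "S = (\<Sum>i=1..n. H $ i * U $ (n - i))"
    have "degree S \<le> w n"
      unfolding S_def
    proof (intro degree_sum_le)
      fix i assume i: "i \<in> {1..n}"
      have "degree (H $ i * U $ (n - i)) \<le> degree (H $ i) + degree (U $ (n - i))"
        by (rule degree_mult_le)
      also have "\<dots> \<le> w i + w (n - i)"
        using i by (intro add_mono deg less) auto
      also have "\<dots> \<le> w n" using super[of i "n - i"] i by simp
      finally show "degree (H $ i * U $ (n - i)) \<le> w n" .
    qed simp
    have "(H * U) $ n = smult h (U $ n) + S"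
      by (simp add: fps_mult_nth sum.atLeast_Suc_atMost S_def H0)
    hence "smult h (U $ n) = (if n = 0 then 1 else 0) - S" by (simp add: HU)
    hence "degree (smult h (U $ n)) \<le> w n"
      using \<open>degree S \<le> w n\<close> by (auto intro: degree_diff_le)
    thus ?case using H0 by simp
  qed
  with HU show thesis by (rule that)
qed

definition M_fps :: "nat \<Rightarrow> 'a::field fps \<Rightarrow> 'a poly fps" where
  "M_fps a F = Abs_fps (\<lambda>j. M_series a F $$ int j)"

definition N_fps :: "nat \<Rightarrow> 'a::field fps \<Rightarrow> 'a poly fps" where
  "N_fps a F = Abs_fps (\<lambda>j. N_series a F $$ (int j + 1 - int a))"

lemma M_series_fps:
  assumes "a \<ge> 1"
  shows "M_series a F = fps_to_fls (M_fps a F)"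
proof (rule fls_eqI)
  fix j
  have "M_series a F $$ j = 0" if "j < 0"
    using W_series_order(1)[OF assms assms order_refl, of F j] that
    by (force simp: M_series_eq poly_eq_iff)
  thus "M_series a F $$ j = fps_to_fls (M_fps a F) $$ j" by (simp add: M_fps_def)
qed

lemma N_series_fps:
  assumes "a \<ge> 1"
  shows "N_series a F = qpow (1 - int a) * fps_to_fls (N_fps a F)"
proof (rule fls_eqI)
  fix j
  have "N_series a F $$ j = 0" if "j < 1 - int a"
    using W_series_order(1)[OF assms order_refl assms, of F j] that
    by (force simp: N_series_eq poly_eq_iff)
  thus "N_series a F $$ j = (qpow (1 - int a) * fps_to_fls (N_fps a F)) $$ j"
    by (simp add: N_fps_def)
qed

text \<open>For i >= 2 the \<open>x^i\<close>-coefficient of M starts at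
  \<open>q^(a (i - 1))\<close> or later.\<close>

lemma degree_M_fps:
  assumes "a \<ge> 1"
  shows "degree (M_fps a F $ j) \<le> Suc (j div a)"
proof (rule degree_le, intro allI impI, rule ccontr)
  fix i assume i: "Suc (j div a) < i" and nz: "coeff (M_fps a F $ j) i \<noteq> 0"
  have "2 * int a + int a * int (i - 2) - int a \<le> int j"
    using i by (intro W_series_order(2)[OF assms assms order_refl, of F])
      (use nz in \<open>simp_all add: M_fps_def M_series_eq\<close>)
  hence "int (a * (i - 1)) \<le> int j" using i by (simp add: algebra_simps of_nat_diff)
  hence "a * (i - 1) \<le> j" by linarith
  hence "i - 1 \<le> j div a" using assms by (simp add: less_eq_div_iff_mult_less_eq mult.commute)
  thus False using i by simp
qed

text \<open>For i >= 2 a nonzero \<open>x^i\<close>-coefficient at shifted index j requires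
  \<open>a (i - 2) + 1 <= j\<close>, that is, \<open>a (i - 1) <= j + a - 1\<close>.\<close>

lemma degree_N_fps:
  assumes "a \<ge> 1"
  shows "degree (N_fps a F $ j) \<le> Suc ((j + a - 1) div a)"
proof (rule degree_le, intro allI impI, rule ccontr)
  fix i assume i: "Suc ((j + a - 1) div a) < i" and nz: "coeff (N_fps a F $ j) i \<noteq> 0"
  have "2 * int 1 + int a * int (i - 2) - int a \<le> int j + 1 - int a"
    using i by (intro W_series_order(2)[OF assms order_refl assms, of F])
      (use nz in \<open>simp_all add: N_fps_def N_series_eq\<close>)
  hence "int (a * (i - 1)) \<le> int (j + a - 1)" 
    using i assms by (simp add: algebra_simps of_nat_diff)
  hence "a * (i - 1) \<le> j + a - 1" by linarith
  hence "i - 1 \<le> (j + a - 1) div a" using assms by (simp add: less_eq_div_iff_mult_less_eq mult.commute)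
  thus False using i by simp
qed

lemma ceiling_divide_nat:
  assumes "a \<ge> 1"
  shows "\<lceil>real r / real a\<rceil> = int ((r + a - 1) div a)"
proof -
  define k where "k = (r + a - 1) div a"
  have "a * k \<le> r + a - 1" by (simp add: k_def)
  hence 1: "a * k < r + a" using assms by linarith
  have "r + a - 1 < a * k + a"
    using assms unfolding k_def by (metis dividend_less_times_div le_eq_less_or_eq less_one
        not_le order_less_le_trans zero_less_one add.commute mult_Suc_right)
  hence 2: "r \<le> a * k" using assms by linarith
  have "real a * real k < real r + real a" "real r \<le> real a * real k"
    using 1 2 by (metis of_nat_add of_nat_less_iff of_nat_mult, metis of_nat_le_iff of_nat_mult)
  thus ?thesis unfolding k_def[symmetric] using assms
    by (intro ceiling_unique) (simp_all add: field_simps)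
qed

section \<open>The pole and the polynomial remainder\<close>

text \<open>Comparing x-coefficients in (x_0 - x) P = rho gives p_0 x_0 = rho and p_(m+1) x_0 =
  p_m.\<close>

lemma pole_part_nth:
  assumes "x0 $ 0 \<noteq> 0"
  shows "pole_part \<rho> x0 $$ j $ m = (\<rho> * fps_to_fls x0 powi (- int m - 1)) $$ j"
proof -
  define P where "P = pole_part \<rho> x0"
  define p where "p = (\<lambda>m. fls_map_coeffs (\<lambda>f. f $ m) P)"
  define X where "X = fls_map_coeffs fps_const (fps_to_fls x0)"
  have p: "p m $$ j = P $$ j $ m" for m j by (simp add: p_def fls_map_coeffs_nth)
  have X: "X $$ j = fps_const (fps_to_fls x0 $$ j)" for j by (simp add: X_def fls_map_coeffs_nth)
  have x0: "x0 \<noteq> 0" using assms by auto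
  \<comment> \<open>\<open>X\<close> is constant in x, so it multiplies every x-coefficient
    separately; factoring out \<open>q^N\<close> reduces this to convolutions of power
    series.\<close>
  have PX: "(P * X) $$ j $ m = (p m * fps_to_fls x0) $$ j" for j m
  proof -
    obtain N where N: "\<forall>i<N. P $$ i = 0" by (rule fls_nth_vanishes_belowE)
    define P' where "P' = Abs_fps (\<lambda>i. P $$ (int i + N))"
    have "X = fps_to_fls (Abs_fps (\<lambda>n. fps_const (x0 $ n)))"
      by (rule fls_eqI) (simp add: X)
    moreover have "P = qpow N * fps_to_fls P'"
      by (rule fls_eqI) (use N in \<open>simp add: P'_def\<close>)
    ultimately have "P * X = qpow N * fps_to_fls (P' * Abs_fps (\<lambda>n. fps_const (x0 $ n)))"
      by (simp add: fls_times_fps_to_fls mult.assoc)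
    moreover have "p m = qpow N * fps_to_fls (Abs_fps (\<lambda>i. P' $ i $ m))"
      by (rule fls_eqI) (use N in \<open>simp add: P'_def p\<close>)
    hence "p m * fps_to_fls x0 = qpow N * fps_to_fls (Abs_fps (\<lambda>i. P' $ i $ m) * x0)"
      by (simp add: fls_times_fps_to_fls mult.assoc)
    ultimately show ?thesis
      by (simp add: fps_mult_nth[of P'] fps_mult_nth[of "Abs_fps (\<lambda>i. P' $ i $ m)"] fps_sum_nth)
  qed
  have "P * (X - fls_const fps_X) = fls_map_coeffs fps_const \<rho>"
    unfolding P_def X_def by (rule pole_part_mult[OF assms])
  hence eq: "P * X = fls_map_coeffs fps_const \<rho> + fls_const fps_X * P"
    by (simp add: algebra_simps)
  have eq_nth: "(p m * fps_to_fls x0) $$ j = (if m = 0 then \<rho> $$ j else p (m - 1) $$ j)" for m j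
    unfolding PX[symmetric] eq by (simp add: fls_map_coeffs_nth p)
  have "p m = \<rho> * fps_to_fls x0 powi (- int m - 1)" for m
  proof (induction m)
    case 0
    have "p 0 * fps_to_fls x0 = \<rho>" by (rule fls_eqI) (simp add: eq_nth)
    thus ?case using x0 by (auto simp: power_int_minus field_simps)
  next
    case (Suc m)
    have "p (Suc m) * fps_to_fls x0 = p m" by (rule fls_eqI) (simp add: eq_nth)
    hence "p (Suc m) = p m * fps_to_fls x0 powi (-1)"
      using x0 by (auto simp: power_int_minus field_simps)
    also have "\<dots> = \<rho> * fps_to_fls x0 powi ((- int m - 1) + (-1))"
      unfolding Suc mult.assoc using x0 by (subst power_int_add) auto
    finally show ?case by (simp add: algebra_simps)
  qed
  thus ?thesis using p by (simp add: P_def)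
qed

text \<open>The degree bound at index 0 makes \<open>H $ 0\<close> a constant, which the
  x-coefficient of M at \<open>q^0\<close> determines. It serves both the uniqueness of the root and
  the inversion of \<open>H\<close>.\<close>

lemma M_root_division:
  assumes a: "a \<ge> 1" and F0: "F $ 0 = 1" and root: "fls_eval (M_series a F) x0 = 0"
  obtains H where "M_fps a F = root_factor x0 * H" and "\<And>n. degree (H $ n) \<le> n div a"
    and "H $ 0 = [:1 + F $ 1:]"
proof -
  have "eval_at (M_fps a F) x0 = 0"
    using root by (simp add: M_series_fps[OF a] fls_eval_fps_to_fls)
  then obtain H where H: "M_fps a F = root_factor x0 * H" "\<And>n. degree (H $ n) \<le> n div a"
    using root_division[of "\<lambda>n. n div a" "M_fps a F" x0] degree_M_fps[OF a]
    by (auto simp: mono_def div_le_mono)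
  from H(2)[of 0] obtain h where h: "H $ 0 = [:h:]" by (auto elim: degree_eq_zeroE)
  have "[:1, - (1 + F $ 1):] = [:x0 $ 0, -1:] * [:h:]"
    using arg_cong[OF H(1), of "\<lambda>P. P $ 0"] M_series_0[OF a F0]
    by (simp add: M_fps_def root_factor_def h)
  hence "h = 1 + F $ 1" by (simp add: eq_neg_iff_add_eq_0 algebra_simps) 
  with H h show thesis by (intro that) auto
qed

lemma eval_at_nth_0: "P $ 0 = [:c:] \<Longrightarrow> eval_at P g $ 0 = c"
  by (simp add: eval_at_nth)

text \<open>In K((q))[[x]] both the polynomiality of the remainder and the formula for the C_m can
  be read off coefficient by coefficient.\<close>

lemma remainder_polynomial:
  fixes F :: "'a::field fps"
  assumes a: "a \<ge> 2" and F0: "F $ 0 = 1" and F1: "F $ 1 \<noteq> -1"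
    and x00: "x0 $ 0 = 1 / (1 + F $ 1)" and root: "fls_eval (M_series a F) x0 = 0"
  obtains c V where "rho_series a F x0 = qpow (1 - int a) * fps_to_fls c"
    and "c $ 0 = - F $ 1 / (1 + F $ 1) ^ 2"
    and "\<And>r. degree (V $ r) \<le> (r + a - 1) div a"
    and "q_rescale a (R_series a F) =
      Abs_fps (\<lambda>m. rho_series a F x0 * fps_to_fls x0 powi (- int m - 1))
      + fps_const (qpow (1 - int a)) * x_expand (fps_to_fls V)"
proof -
  have a1: "a \<ge> 1" using a by simp
  have F1': "1 + F $ 1 \<noteq> 0" using F1 by (simp add: add_eq_0_iff)
  obtain H where H: "M_fps a F = root_factor x0 * H" and H_deg: "\<And>n. degree (H $ n) \<le> n div a"
    and H0: "H $ 0 = [:1 + F $ 1:]"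
    using M_root_division[OF a1 F0 root] by blast
  define h where "h = eval_at H x0"
  have h0: "h $ 0 = 1 + F $ 1" unfolding h_def by (rule eval_at_nth_0[OF H0])
  have h: "h \<noteq> 0" using h0 F1' by auto
  define n where "n = N_fps a F"
  \<comment> \<open>Since M_x(x_0) = - h, the signs in rho cancel, and \<open>c\<close> is rho up to
    the power \<open>q^(1-a)\<close>.\<close>
  define c where "c = eval_at n x0 * inverse h"
  have ch: "c * h = eval_at n x0"
    using inverse_mult_eq_1[of h] h0 F1' by (simp add: c_def mult.assoc)
  have M_x: "fls_eval (M_x_series a F) x0 = - fps_to_fls h"
    unfolding M_x_series_def M_series_fps[OF a1] fls_map_coeffs_pderiv fls_eval_fps_to_fls H
      eval_at_pderiv_root by (simp add: h_def)
  have N: "fls_eval (N_series a F) x0 = qpow (1 - int a) * fps_to_fls c * fps_to_fls h"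
    unfolding N_series_fps[OF a1] fls_eval_qpow_times
    by (simp add: ch[unfolded n_def, symmetric] fls_times_fps_to_fls mult.assoc)
  have rho: "rho_series a F x0 = qpow (1 - int a) * fps_to_fls c"
    unfolding rho_series_def N M_x using h by simp
  have "n $ 0 = [:0, - F $ 1:]"
    using N_series_lowest[OF a, of F] by (simp add: n_def N_fps_def)
  hence "eval_at n x0 $ 0 = - F $ 1 / (1 + F $ 1)"
    by (simp add: eval_at_nth x00)
  hence c0: "c $ 0 = - F $ 1 / (1 + F $ 1) ^ 2"
    by (simp add: c_def h0 power2_eq_square divide_inverse mult_ac)
  define w where "w = (\<lambda>r. (r + a - 1) div a)"
  have div_add: "i div a + j div a \<le> (i + j) div a" for i j
  proof -
    have "i div a + j div a = (a * (i div a) + j) div a" using a1 by simp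
    also have "\<dots> \<le> (i + j) div a" by (intro div_le_mono add_right_mono) simp
    finally show ?thesis .
  qed
  have w_add: "i div a + w j \<le> w (i + j)" for i j
    using div_add[of i "j + a - 1"] a1 by (simp add: w_def add.assoc)
  \<comment> \<open>Subtracting \<open>c H\<close> makes the numerator vanish at x_0; the degree
    bound of \<open>n\<close> survives because \<open>r div a <= w r\<close>.\<close>
  define D where "D = n - fps_of_coeffs c * H"
  have "degree (D $ r) \<le> Suc (w r)" for r
  proof -
    have "degree ((fps_of_coeffs c * H) $ r) \<le> r div a"
      by (rule degree_fps_mult_nth_le[where u = "\<lambda>_. 0", OF _ H_deg])
        (auto intro: div_le_mono)
    also have "\<dots> \<le> Suc (w r)" using a1 unfolding w_def by (intro le_SucI div_le_mono) simp
    finally show ?thesis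
      using degree_N_fps[OF a1, of F r] unfolding D_def fps_sub_nth n_def w_def
      by (intro degree_diff_le)
  qed
  moreover have "eval_at D x0 = 0"
    by (simp add: D_def eval_at_diff eval_at_mult ch h_def[symmetric])
  moreover have "mono w" by (auto simp: mono_def w_def intro!: div_le_mono)
  ultimately obtain T where T: "D = root_factor x0 * T" and T_deg: "\<And>r. degree (T $ r) \<le> w r"
    using root_division[of w D x0] by blast
  obtain U where HU: "H * U = 1" and U_deg: "\<And>r. degree (U $ r) \<le> r div a"
    using fps_inverse_degree_le[OF H0 F1' H_deg div_add] by blast
  define V where "V = U * T"
  have V_deg: "degree (V $ r) \<le> w r" for r
    unfolding V_def by (rule degree_fps_mult_nth_le[OF U_deg T_deg]) (use w_add in auto)
  define E where "E = (\<lambda>P :: 'a poly fps. x_expand (fps_to_fls P))"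
  have E_mult: "E (P * Q) = E P * E Q" for P Q by (simp add: E_def x_expand_mult)
  have E_1: "E 1 = 1"
    using x_expand_fps_of_coeffs[of "1 :: 'a fps"] fps_of_coeffs_const[of "1 :: 'a"]
    by (simp add: E_def flip: one_pCons)
  define L where "L = fps_const (fps_to_fls x0) - fps_X"
  have L: "E (root_factor x0) = L" by (simp add: E_def L_def x_expand_root_factor)
  have "L $ 1 \<noteq> 0" by (simp add: L_def)
  hence L_nz: "L \<noteq> 0" by auto
  define \<rho> where "\<rho> = rho_series a F x0"
  define pole where "pole = Abs_fps (\<lambda>m. \<rho> * fps_to_fls x0 powi (- int m - 1))"
  define q where "q = fps_const (qpow (1 - int a) :: 'a fls)"
  define R where "R = q_rescale a (R_series a F)"
  have x0_nz: "x0 \<noteq> 0" using x00 F1' by auto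
  have pole_Suc: "fps_to_fls x0 * pole $ Suc k = pole $ k" for k
  proof -
    have 1: "- int (Suc k) - 1 = (- int k - 1) - 1" by simp
    have 2: "fps_to_fls x0 powi ((- int k - 1) - 1) = fps_to_fls x0 powi (- int k - 1) / fps_to_fls x0"
      using x0_nz by (subst power_int_diff) auto
    show ?thesis
      unfolding pole_def fps_nth_Abs_fps 1 2 using x0_nz by simp
  qed
  have pole_0: "fps_to_fls x0 * pole $ 0 = \<rho>"
    using x0_nz by (simp add: pole_def power_int_minus)
  have pole: "pole * L = fps_const \<rho>"
  proof (rule fps_ext)
    fix m
    have "pole * L = fps_const (fps_to_fls x0) * pole - fps_X * pole"
      by (simp add: L_def algebra_simps)
    thus "(pole * L) $ m = fps_const \<rho> $ m"
      by (cases m) (simp_all add: pole_Suc pole_0)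
  qed
  have "R * E (M_fps a F) = q * E n"
    using R_series_M_N[OF a1 F0]
    by (simp add: R_def E_def q_def n_def M_series_fps[OF a1] N_series_fps[OF a1]
        x_expand_qpow_times)
  hence R: "R * (L * E H) = q * E n" by (simp add: H E_mult L)
  have E_D: "E D = E n - fps_const (fps_to_fls c) * E H"
    unfolding D_def by (simp add: E_def x_expand_diff x_expand_mult x_expand_fps_of_coeffs)
  \<comment> \<open>After multiplication by \<open>L * E H\<close> the difference of R and the pole
    is \<open>q * E D\<close>, which again contains the factor \<open>L\<close>.\<close>
  have "L * ((R - pole) * E H) = R * (L * E H) - (pole * L) * E H"
    by (simp add: algebra_simps)
  also have "\<dots> = q * E D"
    unfolding R pole E_D \<rho>_def rho q_def by (simp add: algebra_simps flip: fps_const_mult)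
  also have "\<dots> = L * (q * E T)" by (simp add: T E_mult L)
  finally have "(R - pole) * E H = q * E T" using L_nz by simp
  hence "(R - pole) * (E H * E U) = q * (E U * E T)" by (simp add: mult_ac)
  hence "R = pole + q * E V"
    by (simp add: E_mult[symmetric] HU E_1 V_def algebra_simps)
  with rho c0 V_deg show thesis
    by (intro that[of c V]) (simp_all add: R_def pole_def q_def E_def \<rho>_def w_def)
qed

theorem theorem2p9:
  fixes F :: "'a::field_char_0 fps" and a :: nat
  assumes "a \<ge> 2" and "F $ 0 = 1" and "F $ 1 \<noteq> 0" and "F $ 1 \<noteq> -1"
  shows
    "(\<exists>!x0. x0 \<in> fps_in_power a \<and> x0 $ 0 = 1 / (1 + F $ 1) \<and> fls_eval (M_series a F) x0 = 0) \<and>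
     (\<forall>x0. x0 \<in> fps_in_power a \<and> x0 $ 0 = 1 / (1 + F $ 1) \<and> fls_eval (M_series a F) x0 = 0 \<longrightarrow>
       (\<forall>j < 2 - int a.
          (rho_series a F x0 - fls_const (- F $ 1 / (1 + F $ 1) ^ 2) * fls_X_intpow (1 - int a)) $$ j = 0) \<and>
       (\<forall>r::nat. \<exists>p::'a poly. int (degree p) \<le> \<lceil>real r / real a\<rceil> \<and>
          (R_subst a F - pole_part (rho_series a F x0) x0) $$ (int r - int a + 1) = fps_of_poly p) \<and>
       (\<forall>r m::nat. int m \<ge> \<lceil>real r / real a\<rceil> + 1 \<longrightarrow>
          fps_to_fls (C_coeff a F m) $$ (int a * int m - int a + 1 + int r) =
          (rho_series a F x0 * fps_to_fls x0 powi (- int m - 1)) $$ (int r - int a + 1)))"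
proof (intro conjI allI impI)
  have a: "a \<ge> 1" using assms(1) by simp
  have F1: "1 + F $ 1 \<noteq> 0" using assms(4) by (simp add: add_eq_0_iff)
  show "\<exists>!x0. x0 \<in> fps_in_power a \<and> x0 $ 0 = 1 / (1 + F $ 1) \<and> fls_eval (M_series a F) x0 = 0"
  proof (rule ex_ex1I)
    have M0: "M_fps a F $ 0 = [:1, - (1 + F $ 1):]"
      using M_series_0[OF a assms(2)] by (simp add: M_fps_def)
    have supp: "M_fps a F $ n = 0" if "\<not> a dvd n" for n
      using M_series_support[OF a, of "int n" F] that by (simp add: M_fps_def)
    obtain g where "g \<in> fps_in_power a" "g $ 0 = - 1 / - (1 + F $ 1)" "eval_at (M_fps a F) g = 0"
      using root_exists[OF M0 _ _ supp] F1 a by (metis neg_equal_0_iff_equal not_one_le_zero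
          bot_nat_0.not_eq_extremum)
    moreover have "- 1 / - (1 + F $ 1) = 1 / (1 + F $ 1)" by (rule minus_divide_divide)
    ultimately show "\<exists>x0. x0 \<in> fps_in_power a \<and> x0 $ 0 = 1 / (1 + F $ 1) \<and> fls_eval (M_series a F) x0 = 0"
      by (intro exI[of _ g]) (simp only: M_series_fps[OF a] fls_eval_fps_to_fls fps_to_fls_eq_0_iff simp_thms)
  next
    fix x y
    assume x: "x \<in> fps_in_power a \<and> x $ 0 = 1 / (1 + F $ 1) \<and> fls_eval (M_series a F) x = 0"
      and y: "y \<in> fps_in_power a \<and> y $ 0 = 1 / (1 + F $ 1) \<and> fls_eval (M_series a F) y = 0"
    obtain H where H: "M_fps a F = root_factor x * H" "H $ 0 = [:1 + F $ 1:]"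
      using M_root_division[OF a assms(2)] x by blast
    \<comment> \<open>M(y) = (x - y) H(y), and H(y) has constant term 1 + f_1, so only the first
      factor can vanish.\<close>
    have "eval_at H y \<noteq> 0" using eval_at_nth_0[OF H(2), of y] F1 by auto
    moreover have "(x - y) * eval_at H y = 0"
      using y by (simp add: M_series_fps[OF a] fls_eval_fps_to_fls H(1) eval_at_mult eval_at_root_factor)
    ultimately show "x = y" by simp
  qed
next
  fix x0 :: "'a fps"
  assume x0: "x0 \<in> fps_in_power a \<and> x0 $ 0 = 1 / (1 + F $ 1) \<and> fls_eval (M_series a F) x0 = 0"
  have a: "a \<ge> 1" using assms(1) by simp
  have F1: "1 + F $ 1 \<noteq> 0" using assms(4) by (simp add: add_eq_0_iff)
  obtain c V where rho: "rho_series a F x0 = qpow (1 - int a) * fps_to_fls c"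
    and c0: "c $ 0 = - F $ 1 / (1 + F $ 1) ^ 2"
    and V_deg: "\<And>r. degree (V $ r) \<le> (r + a - 1) div a"
    and R: "q_rescale a (R_series a F) =
      Abs_fps (\<lambda>m. rho_series a F x0 * fps_to_fls x0 powi (- int m - 1))
      + fps_const (qpow (1 - int a)) * x_expand (fps_to_fls V)"
    using remainder_polynomial[OF assms(1,2,4)] x0 by blast
  \<comment> \<open>The coefficient of \<open>x^m q^j\<close> in R(x/q^a, q) is that of
    \<open>q^(j + a m)\<close> in C_m.\<close>
  have C: "fps_to_fls (C_coeff a F m) $$ (j + int a * int m) =
      (rho_series a F x0 * fps_to_fls x0 powi (- int m - 1)) $$ j
      + coeff (fps_to_fls V $$ (j - (1 - int a))) m" for m j
    using arg_cong[OF R, of "\<lambda>P. P $ m $$ j"]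
    by (simp add: q_rescale_def C_coeff_def x_expand_def)
  {
    fix j assume "j < 2 - int a"
    thus "(rho_series a F x0 - fls_const (- F $ 1 / (1 + F $ 1) ^ 2) * fls_X_intpow (1 - int a)) $$ j = 0"
      unfolding rho qpow_def[symmetric] by (cases "j = 1 - int a") (simp_all add: c0)
  next
    fix r
    have x00: "x0 $ 0 \<noteq> 0" using x0 F1 by simp
    have "(R_subst a F - pole_part (rho_series a F x0) x0) $$ (int r - int a + 1) $ m =
        fps_of_poly (V $ r) $ m" for m
      unfolding fls_minus_nth fps_sub_nth R_subst_nth(1)[OF a assms(2)] fps_nth_Abs_fps
        pole_part_nth[OF x00] C by simp
    hence "(R_subst a F - pole_part (rho_series a F x0) x0) $$ (int r - int a + 1) =
        fps_of_poly (V $ r)" by (rule fps_ext)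
    thus "\<exists>p. int (degree p) \<le> \<lceil>real r / real a\<rceil> \<and>
        (R_subst a F - pole_part (rho_series a F x0) x0) $$ (int r - int a + 1) = fps_of_poly p"
      using V_deg[of r] by (intro exI[of _ "V $ r"]) (simp add: ceiling_divide_nat[OF a])
  next
    fix r m :: nat
    assume "int m \<ge> \<lceil>real r / real a\<rceil> + 1"
    \<comment> \<open>Beyond the degree of \<open>V $ r\<close> only the pole contributes.\<close>
    hence "degree (V $ r) < m" using V_deg[of r] by (simp add: ceiling_divide_nat[OF a])
    hence "coeff (V $ r) m = 0" by (rule coeff_eq_0)
    moreover have "int a * int m - int a + 1 + int r = (int r - int a + 1) + int a * int m" by simp
    ultimately show "fps_to_fls (C_coeff a F m) $$ (int a * int m - int a + 1 + int r) =
        (rho_series a F x0 * fps_to_fls x0 powi (- int m - 1)) $$ (int r - int a + 1)"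
      by (simp only: C) simp
  }
qed

end
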